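(* The global caching algorithm returns `Yes' on input $\phi_0$ if $\phi_0$ is satisfiable.
   Context: Setting: $\phi_0$ is a closed, guarded, clean, irredundant formula of the alternation-free modal $\mu$-calculus ($\psi,\phi ::= \bot \mid \top \mid p \mid \neg p \mid X \mid \psi\wedge\phi \mid \psi\vee\phi \mid \langle a \rangle\psi \mid [a]\psi \mid \mu X.\,\psi \mid \nu X.\,\psi$, no subformula containing both a free $\mu$- and a free $\nu$-variable), interpreted over Kripke structures. Tableau rules (premise / conclusions): $(\bot)$: $\Gamma,\bot$ / no conclusion; (clash): $\Gamma,p,\neg p$ / no conclusion; $(\wedge)$: $\Gamma,\psi\wedge\phi$ / $\Gamma,\psi,\phi$; $(\vee)$: $\Gamma,\psi\vee\phi$ / $\Gamma,\psi$ and $\Gamma,\phi$; $(\langle a\rangle)$: $\Gamma,[a]\psi_1,\ldots,[a]\psi_n,\langle a\rangle\phi$ / $\psi_1,\ldots,\psi_n,\phi$; $(\eta)$: $\Gamma,\eta X.\,\psi$ / $\Gamma,\psi[X\mapsto\eta X.\,\psi]$. Nodes are subsets of the Fischer–Ladner closure of $\phi_0$; $\mathrm{concl}(\Delta)$ is the set of conclusion sets of the modal rules (if $\Delta$ is a state node, i.e. contains only $\top$, non-clashing propositional literals and modal literals) or of the other rules (otherwise) with premise $\Delta$. Focused nodes $(\Gamma,d)$ with $d\subseteq\Gamma$ a set of deferrals; $d(\Gamma)$ = all deferrals in $\Gamma$; $d_{\Delta\leadsto\Gamma}$ = deferrals obtained by tracking $d$ to a conclusion $\Gamma$ of $\Delta$,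 $\emptyset_{\Delta\leadsto\Gamma}=d(\Gamma)$. With $f(Y)=\{(\Delta,d)\mid \forall \Sigma\in\mathrm{concl}(\Delta).\,\exists\Gamma\in\Sigma.\,(\Gamma,d_{\Delta\leadsto\Gamma})\in Y\}$, $g$ the dual ($\exists\Sigma\,\forall\Gamma$), $F$/$\overline{F}$ the focused nodes with empty/nonempty focus, $\hat{f}_X(Y)=(f(Y)\cap\overline{F})\cup(f(X)\cap F)$, $\hat{g}_X(Y)=(g(Y)\cup F)\cap(g(X)\cup\overline{F})$, and for a node set $G$, $E_G=\nu X.\mu Y.\,\hat{f}_X(Y)$, $A_G=\mu X.\nu Y.\,\hat{g}_X(Y)$ over the focused nodes with label in $G$. The algorithm: $G:=\emptyset$, $\Gamma_0:=\{\phi_0\}$, $U:=\{\Gamma_0\}$; repeatedly pick $t\in U$, set $G:=G\cup\{t\}$, $U:=(U-\{t\})\cup(\bigcup\mathrm{concl}(t)-G)$, optionally computing $E_G$/$A_G$ and returning `Yes' if $(\Gamma_0,d(\Gamma_0))\in E_G$ or `No' if $(\Gamma_0,d(\Gamma_0))\in A_G$; once $U=\emptyset$, return `Yes' iff $(\Gamma_0,d(\Gamma_0))\in E_G$. *)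

theory Defs
  imports Main
begin

datatype fp = Least | Greatest

datatype ('p, 'a, 'v) fm =
    Bot | Top
  | Prp 'p | NPrp 'p
  | Var 'v
  | And "('p, 'a, 'v) fm" "('p, 'a, 'v) fm"
  | Or "('p, 'a, 'v) fm" "('p, 'a, 'v) fm"
  | Dia 'a "('p, 'a, 'v) fm"
  | Box 'a "('p, 'a, 'v) fm"
  | Fix fp 'v "('p, 'a, 'v) fm"

fun FV :: "('p, 'a, 'v) fm \<Rightarrow> 'v set" where
  "FV (Var X) = {X}"
| "FV (And \<psi> \<phi>) = FV \<psi> \<union> FV \<phi>"
| "FV (Or \<psi> \<phi>) = FV \<psi> \<union> FV \<phi>"
| "FV (Dia a \<psi>) = FV \<psi>"
| "FV (Box a \<psi>) = FV \<psi>"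
| "FV (Fix \<eta> X \<psi>) = FV \<psi> - {X}"
| "FV _ = {}"

definition closed_fm :: "('p, 'a, 'v) fm \<Rightarrow> bool" where
  "closed_fm \<phi> \<longleftrightarrow> FV \<phi> = {}"

fun subfms :: "('p, 'a, 'v) fm \<Rightarrow> ('p, 'a, 'v) fm set" where
  "subfms (And \<psi> \<phi>) = insert (And \<psi> \<phi>) (subfms \<psi> \<union> subfms \<phi>)"
| "subfms (Or \<psi> \<phi>) = insert (Or \<psi> \<phi>) (subfms \<psi> \<union> subfms \<phi>)"
| "subfms (Dia a \<psi>) = insert (Dia a \<psi>) (subfms \<psi>)"
| "subfms (Box a \<psi>) = insert (Box a \<psi>) (subfms \<psi>)"
| "subfms (Fix \<eta> X \<psi>) = insert (Fix \<eta> X \<psi>) (subfms \<psi>)"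
| "subfms \<phi> = {\<phi>}"

fun binders :: "('p, 'a, 'v) fm \<Rightarrow> 'v list" where
  "binders (And \<psi> \<phi>) = binders \<psi> @ binders \<phi>"
| "binders (Or \<psi> \<phi>) = binders \<psi> @ binders \<phi>"
| "binders (Dia a \<psi>) = binders \<psi>"
| "binders (Box a \<psi>) = binders \<psi>"
| "binders (Fix \<eta> X \<psi>) = X # binders \<psi>"
| "binders _ = []"

definition clean :: "('p, 'a, 'v) fm \<Rightarrow> bool" where
  "clean \<phi> \<longleftrightarrow> distinct (binders \<phi>) \<and> set (binders \<phi>) \<inter> FV \<phi> = {}"

definition irredundant :: "('p, 'a, 'v) fm \<Rightarrow> bool" where
  "irredundant \<phi> \<longleftrightarrow> (\<forall>\<eta> X \<psi>. Fix \<eta> X \<psi> \<in> subfms \<phi> \<longrightarrow> X \<in> FV \<psi>)"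

text \<open>Every free occurrence of the variable lies below a modality.\<close>
fun guarded_var :: "'v \<Rightarrow> ('p, 'a, 'v) fm \<Rightarrow> bool" where
  "guarded_var X (Var Y) \<longleftrightarrow> X \<noteq> Y"
| "guarded_var X (And \<psi> \<phi>) \<longleftrightarrow> guarded_var X \<psi> \<and> guarded_var X \<phi>"
| "guarded_var X (Or \<psi> \<phi>) \<longleftrightarrow> guarded_var X \<psi> \<and> guarded_var X \<phi>"
| "guarded_var X (Fix \<eta> Y \<psi>) \<longleftrightarrow> X = Y \<or> guarded_var X \<psi>"
| "guarded_var X _ \<longleftrightarrow> True"

definition guarded :: "('p, 'a, 'v) fm \<Rightarrow> bool" where
  "guarded \<phi> \<longleftrightarrow> (\<forall>\<eta> X \<psi>. Fix \<eta> X \<psi> \<in> subfms \<phi> \<longrightarrow> guarded_var X \<psi>)"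

definition fp_vars :: "fp \<Rightarrow> ('p, 'a, 'v) fm \<Rightarrow> 'v set" where
  "fp_vars \<eta> \<phi> = {X. \<exists>\<psi>. Fix \<eta> X \<psi> \<in> subfms \<phi>}"

text \<open>Meant for clean formulas, where the binder of a variable determines its kind.\<close>
definition alternation_free :: "('p, 'a, 'v) fm \<Rightarrow> bool" where
  "alternation_free \<phi> \<longleftrightarrow>
     \<not> (\<exists>\<psi> \<in> subfms \<phi>. FV \<psi> \<inter> fp_vars Least \<phi> \<noteq> {} \<and> FV \<psi> \<inter> fp_vars Greatest \<phi> \<noteq> {})"

record ('w, 'p, 'a) kripke =
  worlds :: "'w set"
  rel :: "'a \<Rightarrow> ('w \<times> 'w) set"
  val :: "'p \<Rightarrow> 'w set"

definition kripke_structure :: "('w, 'p, 'a) kripke \<Rightarrow> bool" where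
  "kripke_structure K \<longleftrightarrow>
     (\<forall>a. rel K a \<subseteq> worlds K \<times> worlds K) \<and> (\<forall>p. val K p \<subseteq> worlds K)"

text \<open>
  The clauses for \<open>Fix\<close> are the Knaster--Tarski fixpoints in the powerset lattice of the
  carrier \<open>worlds K\<close>; \<open>lfp\<close> and \<open>gfp\<close> would range over all sets of the type.
\<close>
fun sem :: "('w, 'p, 'a) kripke \<Rightarrow> ('v \<Rightarrow> 'w set) \<Rightarrow> ('p, 'a, 'v) fm \<Rightarrow> 'w set" where
  "sem K i Bot = {}"
| "sem K i Top = worlds K"
| "sem K i (Prp p) = val K p"
| "sem K i (NPrp p) = worlds K - val K p"
| "sem K i (Var X) = i X"
| "sem K i (And \<psi> \<phi>) = sem K i \<psi> \<inter> sem K i \<phi>"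
| "sem K i (Or \<psi> \<phi>) = sem K i \<psi> \<union> sem K i \<phi>"
| "sem K i (Dia a \<psi>) = {w \<in> worlds K. \<exists>v. (w, v) \<in> rel K a \<and> v \<in> sem K i \<psi>}"
| "sem K i (Box a \<psi>) = {w \<in> worlds K. \<forall>v. (w, v) \<in> rel K a \<longrightarrow> v \<in> sem K i \<psi>}"
| "sem K i (Fix Least X \<psi>) = \<Inter> {S. S \<subseteq> worlds K \<and> sem K (i(X := S)) \<psi> \<subseteq> S}"
| "sem K i (Fix Greatest X \<psi>) = \<Union> {S. S \<subseteq> worlds K \<and> S \<subseteq> sem K (i(X := S)) \<psi>}"

text \<open>
  The type argument supplies the worlds, and the carrier is an arbitrary set of them. The
  interpretation of the variables is irrelevant for closed formulas.
\<close>
definition satisfiable :: "'w itself \<Rightarrow> ('p, 'a, 'v) fm \<Rightarrow> bool" where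
  "satisfiable (_ :: 'w itself) \<phi> \<longleftrightarrow>
     (\<exists>(K :: ('w, 'p, 'a) kripke) w.
        kripke_structure K \<and> w \<in> worlds K \<and> w \<in> sem K (\<lambda>_. {}) \<phi>)"

text \<open>
  No renaming of bound variables: starting from a clean closed formula, substituted formulas
  are closed or have free variables that are not bound in the target, so nothing is captured.
\<close>
fun subst :: "'v \<Rightarrow> ('p, 'a, 'v) fm \<Rightarrow> ('p, 'a, 'v) fm \<Rightarrow> ('p, 'a, 'v) fm" where
  "subst X \<chi> (Var Y) = (if X = Y then \<chi> else Var Y)"
| "subst X \<chi> (And \<psi> \<phi>) = And (subst X \<chi> \<psi>) (subst X \<chi> \<phi>)"
| "subst X \<chi> (Or \<psi> \<phi>) = Or (subst X \<chi> \<psi>) (subst X \<chi> \<phi>)"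
| "subst X \<chi> (Dia a \<psi>) = Dia a (subst X \<chi> \<psi>)"
| "subst X \<chi> (Box a \<psi>) = Box a (subst X \<chi> \<psi>)"
| "subst X \<chi> (Fix \<eta> Y \<psi>) = Fix \<eta> Y (if X = Y then \<psi> else subst X \<chi> \<psi>)"
| "subst X \<chi> \<phi> = \<phi>"

text \<open>Subformulas with an occurrence that is not in the scope of a fixpoint operator.\<close>
fun free_subfms :: "('p, 'a, 'v) fm \<Rightarrow> ('p, 'a, 'v) fm set" where
  "free_subfms (And \<psi> \<phi>) = insert (And \<psi> \<phi>) (free_subfms \<psi> \<union> free_subfms \<phi>)"
| "free_subfms (Or \<psi> \<phi>) = insert (Or \<psi> \<phi>) (free_subfms \<psi> \<union> free_subfms \<phi>)"
| "free_subfms (Dia a \<psi>) = insert (Dia a \<psi>) (free_subfms \<psi>)"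
| "free_subfms (Box a \<psi>) = insert (Box a \<psi>) (free_subfms \<psi>)"
| "free_subfms \<phi> = {\<phi>}"

text \<open>
  A pair \<open>(X, \<psi>)\<close> in a list stands for the fixpoint literal \<open>Fix \<eta> X \<psi>\<close>, with one common
  \<open>\<eta>\<close>. The list \<open>[(X\<^sub>1, \<psi>\<^sub>1), \<dots>, (X\<^sub>n, \<psi>\<^sub>n)]\<close>, with \<open>\<chi>\<^sub>i = Fix \<eta> X\<^sub>i \<psi>\<^sub>i\<close>, stands for
  the sequential substitution of \<open>\<chi>\<^sub>1\<close> for \<open>X\<^sub>1\<close>, then of \<open>\<chi>\<^sub>2\<close> for \<open>X\<^sub>2\<close>, and so on. It
  unfolds \<open>\<chi>\<^sub>n\<close> if each \<open>\<chi>\<^sub>i\<close> is an open subformula immediately below (no fixpoint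
  operator in between) \<open>\<chi>\<^bsub>i+1\<^esub>\<close>.
\<close>
definition open_below :: "('p, 'a, 'v) fm \<Rightarrow> 'v \<times> ('p, 'a, 'v) fm \<Rightarrow> bool" where
  "open_below \<alpha> c \<longleftrightarrow> \<not> closed_fm \<alpha> \<and> \<alpha> \<in> free_subfms (snd c)"

definition fix_lit :: "fp \<Rightarrow> 'v \<times> ('p, 'a, 'v) fm \<Rightarrow> ('p, 'a, 'v) fm" where
  "fix_lit \<eta> c = Fix \<eta> (fst c) (snd c)"

fun seq_subst :: "fp \<Rightarrow> ('v \<times> ('p, 'a, 'v) fm) list \<Rightarrow> ('p, 'a, 'v) fm \<Rightarrow> ('p, 'a, 'v) fm" where
  "seq_subst \<eta> [] \<phi> = \<phi>"
| "seq_subst \<eta> (c # cs) \<phi> = seq_subst \<eta> cs (subst (fst c) (fix_lit \<eta> c) \<phi>)"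

definition seq_unfolds ::
  "fp \<Rightarrow> ('v \<times> ('p, 'a, 'v) fm) list \<Rightarrow> ('p, 'a, 'v) fm \<Rightarrow> bool" where
  "seq_unfolds \<eta> cs \<chi> \<longleftrightarrow>
     cs \<noteq> [] \<and> fix_lit \<eta> (last cs) = \<chi> \<and>
     successively (\<lambda>c c'. open_below (fix_lit \<eta> c) c') cs"

definition irreducible_fm :: "('p, 'a, 'v) fm \<Rightarrow> bool" where
  "irreducible_fm \<chi> \<longleftrightarrow>
     (\<forall>\<eta> cs \<chi>'. seq_unfolds \<eta> cs \<chi>' \<and> \<chi> = seq_subst \<eta> (tl cs) (fix_lit \<eta> (hd cs))
        \<longrightarrow> length cs = 1)"

definition eventuality :: "('p, 'a, 'v) fm \<Rightarrow> bool" where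
  "eventuality \<theta> \<longleftrightarrow> irreducible_fm \<theta> \<and> closed_fm \<theta> \<and> (\<exists>X \<psi>. \<theta> = Fix Least X \<psi>)"

definition dfr :: "('p, 'a, 'v) fm \<Rightarrow> ('p, 'a, 'v) fm set" where
  "dfr \<theta> = {seq_subst Least cs \<alpha> | cs \<alpha>. seq_unfolds Least cs \<theta> \<and> open_below \<alpha> (hd cs)}"

definition deferral :: "('p, 'a, 'v) fm \<Rightarrow> bool" where
  "deferral \<delta> \<longleftrightarrow> (\<exists>\<theta>. eventuality \<theta> \<and> \<delta> \<in> dfr \<theta>)"

type_synonym ('p, 'a, 'v) node = "('p, 'a, 'v) fm set"

text \<open>
  A conclusion of a rule application consists of the new node and the relation that tracks
  formulas of the premise to formulas of the conclusion. The relation belongs to the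
  application and not just to the two nodes: different applications (say, for two actions)
  and the two conclusions of a disjunction rule may yield the same node while tracking
  formulas differently.
\<close>
type_synonym ('p, 'a, 'v) conclusion =
  "('p, 'a, 'v) node \<times> (('p, 'a, 'v) fm \<times> ('p, 'a, 'v) fm) set"

definition replace ::
  "('p, 'a, 'v) node \<Rightarrow> ('p, 'a, 'v) fm \<Rightarrow> ('p, 'a, 'v) fm set \<Rightarrow> ('p, 'a, 'v) conclusion" where
  "replace \<Delta> \<phi> S = ((\<Delta> - {\<phi>}) \<union> S, Id_on (\<Delta> - {\<phi>}) \<union> {\<phi>} \<times> S)"

inductive local_rule :: "('p, 'a, 'v) node \<Rightarrow> ('p, 'a, 'v) conclusion set \<Rightarrow> bool" where
  bot: "Bot \<in> \<Delta> \<Longrightarrow> local_rule \<Delta> {}"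
| clash: "Prp p \<in> \<Delta> \<Longrightarrow> NPrp p \<in> \<Delta> \<Longrightarrow> local_rule \<Delta> {}"
| conj: "And \<psi> \<phi> \<in> \<Delta> \<Longrightarrow> local_rule \<Delta> {replace \<Delta> (And \<psi> \<phi>) {\<psi>, \<phi>}}"
| disj: "Or \<psi> \<phi> \<in> \<Delta> \<Longrightarrow>
    local_rule \<Delta> {replace \<Delta> (Or \<psi> \<phi>) {\<psi>}, replace \<Delta> (Or \<psi> \<phi>) {\<phi>}}"
| unfold: "Fix \<eta> X \<psi> \<in> \<Delta> \<Longrightarrow>
    local_rule \<Delta> {replace \<Delta> (Fix \<eta> X \<psi>) {subst X (Fix \<eta> X \<psi>) \<psi>}}"

inductive modal_rule :: "('p, 'a, 'v) node \<Rightarrow> ('p, 'a, 'v) conclusion set \<Rightarrow> bool" where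
  dia: "Dia a \<phi> \<in> \<Delta> \<Longrightarrow>
    modal_rule \<Delta>
      {(insert \<phi> {\<psi>. Box a \<psi> \<in> \<Delta>}, insert (Dia a \<phi>, \<phi>) {(Box a \<psi>, \<psi>) | \<psi>. Box a \<psi> \<in> \<Delta>})}"

definition state_node :: "('p, 'a, 'v) node \<Rightarrow> bool" where
  "state_node \<Delta> \<longleftrightarrow>
     (\<forall>\<phi> \<in> \<Delta>. \<phi> = Top \<or> (\<exists>p. \<phi> = Prp p) \<or> (\<exists>p. \<phi> = NPrp p)
                \<or> (\<exists>a \<psi>. \<phi> = Dia a \<psi>) \<or> (\<exists>a \<psi>. \<phi> = Box a \<psi>)) \<and>
     \<not> (\<exists>p. Prp p \<in> \<Delta> \<and> NPrp p \<in> \<Delta>)"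

definition concl :: "('p, 'a, 'v) node \<Rightarrow> ('p, 'a, 'v) conclusion set set" where
  "concl \<Delta> = (if state_node \<Delta> then {\<Sigma>. modal_rule \<Delta> \<Sigma>} else {\<Sigma>. local_rule \<Delta> \<Sigma>})"

type_synonym ('p, 'a, 'v) fnode = "('p, 'a, 'v) node \<times> ('p, 'a, 'v) fm set"

definition deferrals :: "('p, 'a, 'v) node \<Rightarrow> ('p, 'a, 'v) fm set" where
  "deferrals \<Gamma> = {\<delta> \<in> \<Gamma>. deferral \<delta>}"

definition track :: "('p, 'a, 'v) fm set \<Rightarrow> ('p, 'a, 'v) conclusion \<Rightarrow> ('p, 'a, 'v) fm set" where
  "track d c = (if d = {} then deferrals (fst c) else deferrals (fst c) \<inter> snd c `` d)"

definition fnodes :: "('p, 'a, 'v) node set \<Rightarrow> ('p, 'a, 'v) fnode set" where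
  "fnodes G = {(\<Gamma>, d). \<Gamma> \<in> G \<and> d \<subseteq> deferrals \<Gamma>}"

definition unfocused :: "('p, 'a, 'v) node set \<Rightarrow> ('p, 'a, 'v) fnode set" where
  "unfocused G = {(\<Gamma>, d) \<in> fnodes G. d = {}}"

definition focused :: "('p, 'a, 'v) node set \<Rightarrow> ('p, 'a, 'v) fnode set" where
  "focused G = {(\<Gamma>, d) \<in> fnodes G. d \<noteq> {}}"

definition ff ::
  "('p, 'a, 'v) node set \<Rightarrow> ('p, 'a, 'v) fnode set \<Rightarrow> ('p, 'a, 'v) fnode set" where
  "ff G Y = {(\<Delta>, d) \<in> fnodes G. \<forall>\<Sigma> \<in> concl \<Delta>. \<exists>c \<in> \<Sigma>. (fst c, track d c) \<in> Y}"

definition gg ::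
  "('p, 'a, 'v) node set \<Rightarrow> ('p, 'a, 'v) fnode set \<Rightarrow> ('p, 'a, 'v) fnode set" where
  "gg G Y = {(\<Delta>, d) \<in> fnodes G. \<exists>\<Sigma> \<in> concl \<Delta>. \<forall>c \<in> \<Sigma>. (fst c, track d c) \<in> Y}"

definition f_hat :: "('p, 'a, 'v) node set \<Rightarrow> ('p, 'a, 'v) fnode set \<Rightarrow>
    ('p, 'a, 'v) fnode set \<Rightarrow> ('p, 'a, 'v) fnode set" where
  "f_hat G X Y = (ff G Y \<inter> focused G) \<union> (ff G X \<inter> unfocused G)"

definition g_hat :: "('p, 'a, 'v) node set \<Rightarrow> ('p, 'a, 'v) fnode set \<Rightarrow>
    ('p, 'a, 'v) fnode set \<Rightarrow> ('p, 'a, 'v) fnode set" where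
  "g_hat G X Y = (gg G Y \<union> unfocused G) \<inter> (gg G X \<union> focused G)"

text \<open>
  Both operators map into \<open>fnodes G\<close>, so these fixpoints coincide with those in the powerset
  lattice of \<open>fnodes G\<close>.
\<close>
definition E_set :: "('p, 'a, 'v) node set \<Rightarrow> ('p, 'a, 'v) fnode set" where
  "E_set G = gfp (\<lambda>X. lfp (\<lambda>Y. f_hat G X Y))"

definition A_set :: "('p, 'a, 'v) node set \<Rightarrow> ('p, 'a, 'v) fnode set" where
  "A_set G = lfp (\<lambda>X. gfp (\<lambda>Y. g_hat G X Y))"

datatype answer = Yes | No

datatype ('p, 'a, 'v) config =
    Expand "('p, 'a, 'v) node set" "('p, 'a, 'v) node set"
  | Check "('p, 'a, 'v) node set" "('p, 'a, 'v) node set"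
  | Return answer

text \<open>
  The algorithm is nondeterministic in the choice of the node to expand and in whether
  intermediate propagation takes place; \<open>continue\<close> covers both skipping the propagation and
  its being inconclusive.
\<close>
inductive gc_step ::
  "('p, 'a, 'v) node \<Rightarrow> ('p, 'a, 'v) config \<Rightarrow> ('p, 'a, 'v) config \<Rightarrow> bool"
  for \<Gamma>\<^sub>0 where
  expand: "t \<in> U \<Longrightarrow> G' = G \<union> {t} \<Longrightarrow> U' = (U - {t}) \<union> (fst ` \<Union> (concl t) - G') \<Longrightarrow>
    gc_step \<Gamma>\<^sub>0 (Expand G U) (Check G' U')"
| continue: "gc_step \<Gamma>\<^sub>0 (Check G U) (Expand G U)"
| early_yes: "(\<Gamma>\<^sub>0, deferrals \<Gamma>\<^sub>0) \<in> E_set G \<Longrightarrow> gc_step \<Gamma>\<^sub>0 (Check G U) (Return Yes)"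
| early_no: "(\<Gamma>\<^sub>0, deferrals \<Gamma>\<^sub>0) \<in> A_set G \<Longrightarrow> gc_step \<Gamma>\<^sub>0 (Check G U) (Return No)"
| final: "gc_step \<Gamma>\<^sub>0 (Expand G {})
    (Return (if (\<Gamma>\<^sub>0, deferrals \<Gamma>\<^sub>0) \<in> E_set G then Yes else No))"

definition gc_init :: "('p, 'a, 'v) fm \<Rightarrow> ('p, 'a, 'v) config" where
  "gc_init \<phi> = Expand {} {{\<phi>}}"

text \<open>Every run terminates, and it does so with the given answer.\<close>
definition gc_returns :: "('p, 'a, 'v) fm \<Rightarrow> answer \<Rightarrow> bool" where
  "gc_returns \<phi> r \<longleftrightarrow>
     \<not> (\<exists>s. s 0 = gc_init \<phi> \<and> (\<forall>i::nat. gc_step {\<phi>} (s i) (s (Suc i)))) \<and>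
     (\<forall>c. (gc_step {\<phi>})\<^sup>*\<^sup>* (gc_init \<phi>) c \<and> \<not> (\<exists>c'. gc_step {\<phi>} c c') \<longrightarrow> c = Return r)"

end

theory Submission
  imports Defs "HOL-Library.Multiset"
begin

text \<open>
  Truth of a formula at a world is witnessed by a well-founded tree that resolves disjunctions,
  diamonds and least fixpoints, and stops at greatest fixpoints. By alternation freeness no
  greatest fixpoint formula of the closure is a deferral, so tracking a focus through a
  satisfied tableau always descends in the witnesses: at modal steps for the whole focus, and at
  local steps for a focused principal formula. Guardedness bounds the number of consecutive
  local steps on other formulas. Hence every focus can be finished, which puts the satisfied
  focused nodes into \<open>E\<close> and keeps them out of \<open>A\<close>; the runs terminate because the closure is
  finite.
\<close>

section \<open>Substitution\<close>

lemma subst_fresh: "X \<notin> FV \<phi> \<Longrightarrow> subst X \<chi> \<phi> = \<phi>"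
  by (induction \<phi>) auto

lemma FV_subst_closed: "FV \<chi> = {} \<Longrightarrow> FV (subst X \<chi> \<phi>) = FV \<phi> - {X}"
  by (induction \<phi>) auto

lemma FV_unfold: "FV (Fix \<eta> X \<psi>) = {} \<Longrightarrow> FV (subst X (Fix \<eta> X \<psi>) \<psi>) = {}"
  by (subst FV_subst_closed) auto

fun psubst :: "('v \<Rightarrow> ('p, 'a, 'v) fm) \<Rightarrow> ('p, 'a, 'v) fm \<Rightarrow> ('p, 'a, 'v) fm" where
  "psubst \<sigma> (Var X) = \<sigma> X"
| "psubst \<sigma> (And \<psi> \<phi>) = And (psubst \<sigma> \<psi>) (psubst \<sigma> \<phi>)"
| "psubst \<sigma> (Or \<psi> \<phi>) = Or (psubst \<sigma> \<psi>) (psubst \<sigma> \<phi>)"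
| "psubst \<sigma> (Dia a \<psi>) = Dia a (psubst \<sigma> \<psi>)"
| "psubst \<sigma> (Box a \<psi>) = Box a (psubst \<sigma> \<psi>)"
| "psubst \<sigma> (Fix \<eta> X \<psi>) = Fix \<eta> X (psubst (\<sigma>(X := Var X)) \<psi>)"
| "psubst \<sigma> \<phi> = \<phi>"

text \<open>Replacements are closed or trivial, so nothing free in them can be captured and
  \<open>psubst\<close> needs no renaming.\<close>

definition closing :: "('v \<Rightarrow> ('p, 'a, 'v) fm) \<Rightarrow> bool" where
  "closing \<sigma> \<longleftrightarrow> (\<forall>Z. FV (\<sigma> Z) = {} \<or> \<sigma> Z = Var Z)"

lemma closing_upd:
  "closing \<sigma> \<Longrightarrow> closing (\<sigma>(X := Var X))"
  "closing \<sigma> \<Longrightarrow> FV \<chi> = {} \<Longrightarrow> closing (\<sigma>(X := \<chi>))"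
  by (auto simp: closing_def)

lemma closing_Var: "closing Var"
  by (simp add: closing_def)

lemma psubst_ident: "(\<And>Z. Z \<in> FV \<phi> \<Longrightarrow> \<sigma> Z = Var Z) \<Longrightarrow> psubst \<sigma> \<phi> = \<phi>"
  by (induction \<phi> arbitrary: \<sigma>) auto

lemma FV_psubst: "closing \<sigma> \<Longrightarrow> FV (psubst \<sigma> \<phi>) \<subseteq> {Z \<in> FV \<phi>. \<sigma> Z = Var Z}"
proof (induction \<phi> arbitrary: \<sigma>)
  case (Var X)
  then show ?case by (auto simp: closing_def)
next
  case (Fix \<eta> X \<psi>)
  have "FV (psubst (\<sigma>(X := Var X)) \<psi>) \<subseteq> {Z \<in> FV \<psi>. (\<sigma>(X := Var X)) Z = Var Z}"
    by (rule Fix.IH[OF closing_upd(1)[OF Fix.prems]])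
  then show ?case by (auto split: if_splits)
qed fastforce+

lemma FV_psubst_closed:
  "closing \<sigma> \<Longrightarrow> (\<And>Z. Z \<in> FV \<phi> \<Longrightarrow> FV (\<sigma> Z) = {}) \<Longrightarrow> FV (psubst \<sigma> \<phi>) = {}"
  using FV_psubst[of \<sigma> \<phi>] by fastforce

text \<open>Replacements at variables other than \<open>X\<close> do not contain \<open>X\<close>,
  so the second substitution leaves them alone. This turns the unfolding of an instance of
  \<open>Fix \<eta> X \<psi>\<close> into an instance of \<open>\<psi>\<close>.\<close>

lemma subst_psubst:
  "closing \<sigma> \<Longrightarrow> subst X \<chi> (psubst (\<sigma>(X := Var X)) \<phi>) = psubst (\<sigma>(X := \<chi>)) \<phi>"
proof (induction \<phi> arbitrary: \<sigma>)
  case (Var Z)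
  then have "Z \<noteq> X \<Longrightarrow> X \<notin> FV (\<sigma> Z)"
    by (auto simp: closing_def dest: spec[of _ Z])
  then show ?case by (auto simp: subst_fresh)
next
  case (Fix \<eta> Y \<psi>)
  show ?case
  proof (cases "X = Y")
    case False
    have "subst X \<chi> (psubst (\<sigma>(Y := Var Y, X := Var X)) \<psi>) = psubst (\<sigma>(Y := Var Y, X := \<chi>)) \<psi>"
      by (rule Fix.IH[OF closing_upd(1)[OF Fix.prems]])
    with False show ?thesis by (simp add: fun_upd_twist del: fun_upd_apply)
  qed (simp del: fun_upd_apply)
qed auto

section \<open>The Fischer--Ladner closure\<close>

fun succs :: "('p, 'a, 'v) fm \<Rightarrow> ('p, 'a, 'v) fm set" where
  "succs (And \<psi> \<phi>) = {\<psi>, \<phi>}"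
| "succs (Or \<psi> \<phi>) = {\<psi>, \<phi>}"
| "succs (Dia a \<psi>) = {\<psi>}"
| "succs (Box a \<psi>) = {\<psi>}"
| "succs (Fix \<eta> X \<psi>) = {subst X (Fix \<eta> X \<psi>) \<psi>}"
| "succs _ = {}"

text \<open>The Fischer--Ladner closure as a set of instances of subformulas:
  \<open>\<sigma>\<close> maps each variable in scope to the fixpoint formula it stands for.
  Recursion on the formula makes finiteness immediate.\<close>

fun closure_under ::
  "('v \<Rightarrow> ('p, 'a, 'v) fm) \<Rightarrow> ('p, 'a, 'v) fm \<Rightarrow> ('p, 'a, 'v) fm set" where
  "closure_under \<sigma> (And \<psi> \<phi>) =
     insert (psubst \<sigma> (And \<psi> \<phi>)) (closure_under \<sigma> \<psi> \<union> closure_under \<sigma> \<phi>)"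
| "closure_under \<sigma> (Or \<psi> \<phi>) =
     insert (psubst \<sigma> (Or \<psi> \<phi>)) (closure_under \<sigma> \<psi> \<union> closure_under \<sigma> \<phi>)"
| "closure_under \<sigma> (Dia a \<psi>) = insert (psubst \<sigma> (Dia a \<psi>)) (closure_under \<sigma> \<psi>)"
| "closure_under \<sigma> (Box a \<psi>) = insert (psubst \<sigma> (Box a \<psi>)) (closure_under \<sigma> \<psi>)"
| "closure_under \<sigma> (Fix \<eta> X \<psi>) =
     insert (psubst \<sigma> (Fix \<eta> X \<psi>)) (closure_under (\<sigma>(X := psubst \<sigma> (Fix \<eta> X \<psi>))) \<psi>)"
| "closure_under \<sigma> \<phi> = {psubst \<sigma> \<phi>}"

lemma finite_closure_under: "finite (closure_under \<sigma> \<phi>)"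
  by (induction \<phi> arbitrary: \<sigma>) auto

lemma psubst_in_closure_under: "psubst \<sigma> \<phi> \<in> closure_under \<sigma> \<phi>"
  by (cases \<phi>) auto

text \<open>\<open>C\<close> stays the whole closure while the induction descends and extends
  \<open>\<sigma>\<close>. The assumption on \<open>succs (\<sigma> Z)\<close> settles variables; on
  entering a fixpoint it holds for the bound variable by \<open>subst_psubst\<close>.\<close>

lemma succs_closure_under:
  assumes "closing \<sigma>" "\<And>Z. Z \<in> FV \<phi> \<Longrightarrow> FV (\<sigma> Z) = {}" "\<And>Z. Z \<in> FV \<phi> \<Longrightarrow> succs (\<sigma> Z) \<subseteq> C"
    and "closure_under \<sigma> \<phi> \<subseteq> C" "\<alpha> \<in> closure_under \<sigma> \<phi>"
  shows "succs \<alpha> \<subseteq> C"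
  using assms
proof (induction \<phi> arbitrary: \<sigma>)
  case (Fix \<eta> X \<psi>)
  let ?\<chi> = "psubst \<sigma> (Fix \<eta> X \<psi>)"
  let ?\<sigma> = "\<sigma>(X := ?\<chi>)"
  have cl: "FV ?\<chi> = {}"
    using Fix.prems(1,2) by (rule FV_psubst_closed)
  have "succs ?\<chi> = {psubst ?\<sigma> \<psi>}"
    using subst_psubst[OF Fix.prems(1), of X ?\<chi> \<psi>] by simp
  then have succ: "succs ?\<chi> \<subseteq> C"
    using psubst_in_closure_under[of ?\<sigma> \<psi>] Fix.prems(4) by auto
  show ?case
  proof (cases "\<alpha> = ?\<chi>")
    case False
    show ?thesis
    proof (rule Fix.IH[of ?\<sigma>])
      show "closing ?\<sigma>" using closing_upd(2)[OF Fix.prems(1) cl] .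
      show "FV (?\<sigma> Z) = {}" if "Z \<in> FV \<psi>" for Z using Fix.prems(2) cl that by auto
      show "succs (?\<sigma> Z) \<subseteq> C" if "Z \<in> FV \<psi>" for Z using Fix.prems(3) succ that by auto
      show "closure_under ?\<sigma> \<psi> \<subseteq> C" using Fix.prems(4) by simp
      show "\<alpha> \<in> closure_under ?\<sigma> \<psi>" using Fix.prems(5) False by simp
    qed
  qed (use succ in simp)
next
  case (And \<psi> \<phi>)
  have *: "\<alpha> = psubst \<sigma> (And \<psi> \<phi>) \<or> \<alpha> \<in> closure_under \<sigma> \<psi> \<or> \<alpha> \<in> closure_under \<sigma> \<phi>"
    using And.prems(5) by auto
  show ?case
    using * And.IH[of \<sigma>] And.prems(1-4) psubst_in_closure_under[of \<sigma> \<psi>]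
      psubst_in_closure_under[of \<sigma> \<phi>] by auto
next
  case (Or \<psi> \<phi>)
  have *: "\<alpha> = psubst \<sigma> (Or \<psi> \<phi>) \<or> \<alpha> \<in> closure_under \<sigma> \<psi> \<or> \<alpha> \<in> closure_under \<sigma> \<phi>"
    using Or.prems(5) by auto
  show ?case
    using * Or.IH[of \<sigma>] Or.prems(1-4) psubst_in_closure_under[of \<sigma> \<psi>]
      psubst_in_closure_under[of \<sigma> \<phi>] by auto
next
  case (Dia a \<psi>)
  then show ?case using psubst_in_closure_under[of \<sigma> \<psi>] by auto
next
  case (Box a \<psi>)
  then show ?case using psubst_in_closure_under[of \<sigma> \<psi>] by auto
qed auto

lemma finite_succs_closed_superset:
  assumes "closed_fm \<phi>"
  obtains C where "finite C" "\<phi> \<in> C" "\<And>\<alpha>. \<alpha> \<in> C \<Longrightarrow> succs \<alpha> \<subseteq> C"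
proof
  show "finite (closure_under Var \<phi>)" by (rule finite_closure_under)
  show "\<phi> \<in> closure_under Var \<phi>" using psubst_in_closure_under[of Var \<phi>] by (simp add: psubst_ident)
  show "succs \<alpha> \<subseteq> closure_under Var \<phi>" if "\<alpha> \<in> closure_under Var \<phi>" for \<alpha>
    using succs_closure_under[OF closing_Var _ _ order_refl that] assms
    by (auto simp: closed_fm_def)
qed

lemma local_rule_subset_succs:
  "local_rule \<Delta> \<Sigma> \<Longrightarrow> c \<in> \<Sigma> \<Longrightarrow> fst c \<subseteq> \<Delta> \<union> \<Union> (succs ` \<Delta>)"
  by (induction rule: local_rule.induct) (force simp: replace_def)+

lemma concl_subset_succs:
  assumes "\<Sigma> \<in> concl \<Delta>" "c \<in> \<Sigma>"
  shows "fst c \<subseteq> \<Delta> \<union> \<Union> (succs ` \<Delta>)"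
proof (cases "state_node \<Delta>")
  case True
  then have "modal_rule \<Delta> \<Sigma>" using assms by (simp add: concl_def)
  then show ?thesis using assms(2) by cases force
next
  case False
  then show ?thesis using assms local_rule_subset_succs[of \<Delta> \<Sigma> c] by (simp add: concl_def)
qed

section \<open>An invariant of the closure\<close>

text \<open>
  Here \<open>L\<close> plays the role of the set of least fixpoint variables. As \<open>X\<close> is free in the body
  of every \<open>Fix Greatest X\<close>, alternation freeness keeps variables of \<open>L\<close> out of that body.
\<close>
fun regular :: "'v set \<Rightarrow> ('p, 'a, 'v) fm \<Rightarrow> bool" where
  "regular L (And \<psi> \<phi>) \<longleftrightarrow> regular L \<psi> \<and> regular L \<phi>"
| "regular L (Or \<psi> \<phi>) \<longleftrightarrow> regular L \<psi> \<and> regular L \<phi>"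
| "regular L (Dia a \<psi>) \<longleftrightarrow> regular L \<psi>"
| "regular L (Box a \<psi>) \<longleftrightarrow> regular L \<psi>"
| "regular L (Fix \<eta> X \<psi>) \<longleftrightarrow> regular L \<psi> \<and> guarded_var X \<psi> \<and>
     (\<eta> = Least \<longrightarrow> X \<in> L) \<and> (\<eta> = Greatest \<longrightarrow> FV \<psi> \<inter> L = {})"
| "regular L _ \<longleftrightarrow> True"

lemma subfms_self: "\<phi> \<in> subfms \<phi>"
  by (cases \<phi>) auto

lemma subfms_trans: "\<alpha> \<in> subfms \<beta> \<Longrightarrow> \<beta> \<in> subfms \<phi> \<Longrightarrow> \<alpha> \<in> subfms \<phi>"
  by (induction \<phi>) auto

lemma regularI:
  assumes "\<And>\<eta> X \<psi>. Fix \<eta> X \<psi> \<in> subfms \<phi> \<Longrightarrow> guarded_var X \<psi> \<and>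
     (\<eta> = Least \<longrightarrow> X \<in> L) \<and> (\<eta> = Greatest \<longrightarrow> FV \<psi> \<inter> L = {})"
  shows "regular L \<phi>"
  using assms
proof (induction \<phi>)
  case (Fix \<eta> X \<psi>)
  show ?case using Fix.IH Fix.prems(1)[of \<eta> X \<psi>] Fix.prems by auto
qed auto

lemma regular_subfms: "regular L \<phi> \<Longrightarrow> \<alpha> \<in> subfms \<phi> \<Longrightarrow> regular L \<alpha>"
  by (induction \<phi>) auto

lemma regular_fp_vars:
  assumes "guarded \<phi>" "irredundant \<phi>" "alternation_free \<phi>"
  shows "regular (fp_vars Least \<phi>) \<phi>"
proof (rule regularI)
  fix \<eta> X \<psi> assume sub: "Fix \<eta> X \<psi> \<in> subfms \<phi>"
  have "X \<in> FV \<psi>" using assms(2) sub by (auto simp: irredundant_def)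
  moreover have "\<psi> \<in> subfms \<phi>"
    using sub by (rule subfms_trans[rotated]) (simp add: subfms_self)
  ultimately show "guarded_var X \<psi> \<and> (\<eta> = Least \<longrightarrow> X \<in> fp_vars Least \<phi>) \<and>
     (\<eta> = Greatest \<longrightarrow> FV \<psi> \<inter> fp_vars Least \<phi> = {})"
    using assms sub unfolding guarded_def alternation_free_def fp_vars_def by blast
qed

lemma guarded_var_fresh: "X \<notin> FV \<phi> \<Longrightarrow> guarded_var X \<phi>"
  by (induction \<phi>) auto

lemma guarded_var_subst:
  "FV \<chi> = {} \<Longrightarrow> guarded_var Y \<phi> \<Longrightarrow> guarded_var Y (subst X \<chi> \<phi>)"
  by (induction \<phi>) (auto simp: guarded_var_fresh)

lemma regular_subst:
  "FV \<chi> = {} \<Longrightarrow> regular L \<chi> \<Longrightarrow> regular L \<phi> \<Longrightarrow> regular L (subst X \<chi> \<phi>)"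
  by (induction \<phi>) (auto simp: guarded_var_subst FV_subst_closed)

lemma regular_succs:
  assumes "FV \<phi> = {}" "regular L \<phi>" "\<psi> \<in> succs \<phi>"
  shows "FV \<psi> = {}" "regular L \<psi>"
proof -
  show "FV \<psi> = {}" using assms FV_unfold by (cases \<phi>) force+
  show "regular L \<psi>" using assms by (cases \<phi>) (auto intro!: regular_subst)
qed

section \<open>Deferrals\<close>

lemma subst_arg_in_subfms: "X \<in> FV \<phi> \<Longrightarrow> \<chi> \<in> subfms (subst X \<chi> \<phi>)"
  by (induction \<phi>) (auto simp: subfms_self)

text \<open>Either \<open>X\<close> is not free in \<open>\<alpha>\<close>, which then stays the
  same, or an inserted copy of \<open>\<chi>\<close> contains \<open>\<alpha>\<close>.\<close>

lemma subfms_subst_self: "\<alpha> \<in> subfms \<chi> \<Longrightarrow> \<alpha> \<in> subfms (subst X \<chi> \<alpha>)"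
  by (metis subfms_self subfms_trans subst_arg_in_subfms subst_fresh)

lemma subfms_subst:
  assumes "\<alpha> \<in> subfms \<chi>" "\<alpha> \<in> subfms \<phi>"
  shows "\<alpha> \<in> subfms (subst X \<chi> \<phi>)"
  using assms
proof (induction \<phi>)
  case (And \<psi> \<phi>)
  show ?case using And subfms_subst_self[OF And.prems(1), of X] by auto
next
  case (Or \<psi> \<phi>)
  show ?case using Or subfms_subst_self[OF Or.prems(1), of X] by auto
next
  case (Dia a \<psi>)
  show ?case using Dia subfms_subst_self[OF Dia.prems(1), of X] by auto
next
  case (Box a \<psi>)
  show ?case using Box subfms_subst_self[OF Box.prems(1), of X] by auto
next
  case (Fix \<eta> Y \<psi>)
  show ?case using Fix subfms_subst_self[OF Fix.prems(1), of X] by auto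
qed (auto simp: subfms_self)

lemma subfms_seq_subst:
  "\<forall>c \<in> set cs. \<alpha> \<in> subfms (fix_lit \<eta> c) \<Longrightarrow> \<alpha> \<in> subfms \<phi> \<Longrightarrow> \<alpha> \<in> subfms (seq_subst \<eta> cs \<phi>)"
  by (induction cs arbitrary: \<phi>) (auto simp: subfms_subst)

lemma free_subfms_subset: "free_subfms \<phi> \<subseteq> subfms \<phi>"
  by (induction \<phi>) auto

lemma FV_free_subfms: "\<alpha> \<in> free_subfms \<phi> \<Longrightarrow> FV \<alpha> \<subseteq> FV \<phi>"
  by (induction \<phi>) auto

lemma open_below_subfms: "open_below \<alpha> c \<Longrightarrow> \<alpha> \<in> subfms (fix_lit \<eta> c)"
  using free_subfms_subset by (auto simp: open_below_def fix_lit_def)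

lemma chain_subfms:
  assumes "successively (\<lambda>c c'. open_below (fix_lit \<eta> c) c') (c # cs)" "c' \<in> set (c # cs)"
  shows "fix_lit \<eta> c \<in> subfms (fix_lit \<eta> c')"
  using assms
proof (induction cs arbitrary: c)
  case Nil
  then show ?case by (simp add: subfms_self)
next
  case (Cons d cs)
  show ?case
  proof (cases "c' = c")
    case False
    then have "fix_lit \<eta> d \<in> subfms (fix_lit \<eta> c')" using Cons by auto
    moreover have "fix_lit \<eta> c \<in> subfms (fix_lit \<eta> d)"
      using Cons.prems(1) by (simp add: open_below_subfms)
    ultimately show ?thesis by (blast intro: subfms_trans)
  qed (simp add: subfms_self)
qed

text \<open>Take the first literal in the list whose variable is free in \<open>\<phi>\<close>. One
  exists, since free variables that are not hit pass outwards and the last literal is closed. Later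
  substitutions keep it because it is a subformula of every later literal.\<close>

lemma seq_subst_contains_fix_lit:
  assumes "successively (\<lambda>c c'. open_below (fix_lit \<eta> c) c') (c # cs)"
    and "FV (fix_lit \<eta> (last (c # cs))) = {}" "FV \<phi> \<noteq> {}" "FV \<phi> \<subseteq> FV (snd c)"
  shows "\<exists>c' \<in> set (c # cs). fst c' \<in> FV \<phi> \<and> fix_lit \<eta> c' \<in> subfms (seq_subst \<eta> (c # cs) \<phi>)"
  using assms
proof (induction cs arbitrary: c)
  case Nil
  then have "fst c \<in> FV \<phi>" by (auto simp: fix_lit_def)
  then show ?case by (simp add: subst_arg_in_subfms)
next
  case (Cons d cs)
  show ?case
  proof (cases "fst c \<in> FV \<phi>")
    case True
    then have "fix_lit \<eta> c \<in> subfms (seq_subst \<eta> (d # cs) (subst (fst c) (fix_lit \<eta> c) \<phi>))"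
      using chain_subfms[OF Cons.prems(1)]
      by (intro subfms_seq_subst) (auto simp: subst_arg_in_subfms)
    with True show ?thesis by auto
  next
    case False
    then have "FV \<phi> \<subseteq> FV (fix_lit \<eta> c)" using Cons.prems(4) by (auto simp: fix_lit_def)
    also have "\<dots> \<subseteq> FV (snd d)"
      using Cons.prems(1) by (auto simp: open_below_def dest: FV_free_subfms)
    finally have "\<exists>c' \<in> set (d # cs). fst c' \<in> FV \<phi> \<and> fix_lit \<eta> c' \<in> subfms (seq_subst \<eta> (d # cs) \<phi>)"
      using Cons by (intro Cons.IH) auto
    then show ?thesis using False by (auto simp: subst_fresh)
  qed
qed

text \<open>Only least fixpoint literals are inserted, so an outermost greatest fixpoint was there
  before.\<close>

lemma seq_subst_eq_Greatest:
  "seq_subst Least cs \<phi> = Fix Greatest Y \<psi> \<Longrightarrow> \<exists>\<psi>'. \<phi> = Fix Greatest Y \<psi>'"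
proof (induction cs arbitrary: \<phi>)
  case (Cons c cs)
  then obtain \<psi>' where "subst (fst c) (fix_lit Least c) \<phi> = Fix Greatest Y \<psi>'" by fastforce
  then show ?case by (cases \<phi>) (auto simp: fix_lit_def split: if_splits)
qed simp

text \<open>Such a deferral would come from an open greatest fixpoint \<open>\<alpha>\<close>, which
  survives as a subformula and hence, by regularity, has no free variable in \<open>L\<close>. Yet a
  least fixpoint literal for some free variable of \<open>\<alpha>\<close> also occurs in the
  deferral, and regularity puts that variable into \<open>L\<close>.\<close>

lemma Greatest_not_deferral:
  assumes "regular L (Fix Greatest Y \<psi>)"
  shows "\<not> deferral (Fix Greatest Y \<psi>)"
proof
  let ?\<delta> = "Fix Greatest Y \<psi>"
  assume "deferral ?\<delta>"
  then obtain \<theta> cs \<alpha> where closed: "closed_fm \<theta>" and \<delta>: "?\<delta> = seq_subst Least cs \<alpha>"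
    and unf: "seq_unfolds Least cs \<theta>" and \<alpha>: "open_below \<alpha> (hd cs)"
    by (auto simp: deferral_def eventuality_def dfr_def)
  obtain c ds where cs: "cs = c # ds" using unf by (cases cs) (auto simp: seq_unfolds_def)
  have chain: "successively (\<lambda>c c'. open_below (fix_lit Least c) c') (c # ds)"
    using unf cs by (simp add: seq_unfolds_def)
  obtain \<alpha>' where \<alpha>': "\<alpha> = Fix Greatest Y \<alpha>'" using seq_subst_eq_Greatest \<delta> by metis
  have "\<alpha> \<in> subfms (fix_lit Least c')" if "c' \<in> set cs" for c'
    using that \<alpha> chain_subfms[OF chain] cs open_below_subfms subfms_trans
    by (metis list.sel(1))
  then have "\<alpha> \<in> subfms ?\<delta>" unfolding \<delta> by (simp add: subfms_seq_subst subfms_self)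
  then have "FV \<alpha> \<inter> L = {}" using regular_subfms[OF assms] \<alpha>' by force
  moreover have "\<exists>c' \<in> set (c # ds). fst c' \<in> FV \<alpha> \<and> fix_lit Least c' \<in> subfms ?\<delta>"
    unfolding \<delta> cs using \<alpha> cs closed unf
    by (intro seq_subst_contains_fix_lit[OF chain])
      (auto simp: seq_unfolds_def closed_fm_def open_below_def dest: FV_free_subfms)
  then obtain c' where "c' \<in> set (c # ds)" "fst c' \<in> FV \<alpha>" "fix_lit Least c' \<in> subfms ?\<delta>"
    by blast
  ultimately show False using regular_subfms[OF assms] by (fastforce simp: fix_lit_def)
qed

section \<open>Semantics\<close>

lemma sem_cong: "(\<And>Z. Z \<in> FV \<phi> \<Longrightarrow> i Z = j Z) \<Longrightarrow> sem K i \<phi> = sem K j \<phi>"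
proof (induction \<phi> arbitrary: i j)
  case (Fix \<eta> X \<psi>)
  have "sem K (i(X := S)) \<psi> = sem K (j(X := S)) \<psi>" for S
    using Fix.prems by (intro Fix.IH) simp
  then show ?case by (cases \<eta>) simp_all
next
  case (And \<psi> \<phi>)
  have "sem K i \<psi> = sem K j \<psi>" "sem K i \<phi> = sem K j \<phi>"
    using And.prems by (auto intro!: And.IH)
  then show ?case by simp
next
  case (Or \<psi> \<phi>)
  have "sem K i \<psi> = sem K j \<psi>" "sem K i \<phi> = sem K j \<phi>"
    using Or.prems by (auto intro!: Or.IH)
  then show ?case by simp
next
  case (Dia a \<psi>)
  have "sem K i \<psi> = sem K j \<psi>" using Dia.prems by (auto intro!: Dia.IH)
  then show ?case by simp
next
  case (Box a \<psi>)
  have "sem K i \<psi> = sem K j \<psi>" using Box.prems by (auto intro!: Box.IH)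
  then show ?case by simp
qed auto

lemma sem_closed: "FV \<phi> = {} \<Longrightarrow> sem K i \<phi> = sem K j \<phi>"
  by (rule sem_cong) simp

lemma sem_mono: "(\<And>Z. i Z \<subseteq> j Z) \<Longrightarrow> sem K i \<phi> \<subseteq> sem K j \<phi>"
proof (induction \<phi> arbitrary: i j)
  case (Fix \<eta> X \<psi>)
  have mono: "sem K (i(X := S)) \<psi> \<subseteq> sem K (j(X := S)) \<psi>" for S
    using Fix.prems by (intro Fix.IH) simp
  show ?case
  proof (cases \<eta>)
    case Least
    then show ?thesis using mono by (simp only: sem.simps) (intro Inter_anti_mono Collect_mono, blast)
  next
    case Greatest
    then show ?thesis using mono by (simp only: sem.simps) (intro Union_mono Collect_mono, blast)
  qed
next
  case (And \<psi> \<phi>)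
  show ?case using And.IH(1)[of i j] And.IH(2)[of i j] And.prems by auto
next
  case (Or \<psi> \<phi>)
  show ?case using Or.IH(1)[of i j] Or.IH(2)[of i j] Or.prems by auto
next
  case (Dia a \<psi>)
  show ?case using Dia.IH[of i j] Dia.prems by auto
next
  case (Box a \<psi>)
  show ?case using Box.IH[of i j] Box.prems by auto
qed auto

lemma sem_subset_worlds:
  "kripke_structure K \<Longrightarrow> (\<And>Z. i Z \<subseteq> worlds K) \<Longrightarrow> sem K i \<phi> \<subseteq> worlds K"
proof (induction \<phi> arbitrary: i)
  case (Fix \<eta> X \<psi>)
  \<comment> \<open>So \<open>worlds K\<close> belongs to the family intersected for
    \<open>Least\<close> and bounds the intersection.\<close>
  have "sem K (i(X := worlds K)) \<psi> \<subseteq> worlds K" using Fix by simp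
  then show ?case by (cases \<eta>) auto
next
  case (And \<psi> \<phi>)
  show ?case using And.IH(1)[of i] And.prems by auto
next
  case (Or \<psi> \<phi>)
  show ?case using Or.IH(1)[of i] Or.IH(2)[of i] Or.prems by auto
qed (auto simp: kripke_structure_def)

lemma sem_subst:
  "FV \<chi> = {} \<Longrightarrow> sem K i (subst X \<chi> \<phi>) = sem K (i(X := sem K i \<chi>)) \<phi>"
proof (induction \<phi> arbitrary: i)
  case (Fix \<eta> Y \<psi>)
  show ?case
  proof (cases "X = Y")
    case True
    then have "i(X := A, Y := S) = i(Y := S)" for A S by simp
    then show ?thesis using True by (cases \<eta>) (simp_all del: fun_upd_apply)
  next
    case False
    then have "sem K (i(Y := S)) (subst X \<chi> \<psi>) = sem K (i(X := sem K i \<chi>, Y := S)) \<psi>" for S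
      using Fix.IH[OF Fix.prems, of "i(Y := S)"] sem_closed[OF Fix.prems, of K "i(Y := S)" i]
      by (simp add: fun_upd_twist del: fun_upd_apply)
    then show ?thesis using False by (cases \<eta>) (simp_all del: fun_upd_apply)
  qed
qed simp_all

lemma sem_Greatest_unfold:
  assumes "FV (Fix Greatest X \<psi>) = {}"
  shows "sem K i (Fix Greatest X \<psi>) \<subseteq> sem K i (subst X (Fix Greatest X \<psi>) \<psi>)"
proof -
  let ?S = "sem K i (Fix Greatest X \<psi>)"
  have "S \<subseteq> sem K (i(X := ?S)) \<psi>" if S: "S \<subseteq> worlds K" "S \<subseteq> sem K (i(X := S)) \<psi>" for S
  proof -
    have "S \<subseteq> ?S" using S by auto
    then have "sem K (i(X := S)) \<psi> \<subseteq> sem K (i(X := ?S)) \<psi>" by (intro sem_mono) simp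
    with S(2) show ?thesis by (rule order_trans)
  qed
  then have "\<Union> {S. S \<subseteq> worlds K \<and> S \<subseteq> sem K (i(X := S)) \<psi>} \<subseteq> sem K (i(X := ?S)) \<psi>"
    by (intro Union_least) blast
  then have "?S \<subseteq> sem K (i(X := ?S)) \<psi>" by (simp only: sem.simps)
  then show ?thesis by (simp only: sem_subst[OF assms])
qed

section \<open>Well-founded witnesses of truth\<close>

text \<open>A substitute for ordinals: branching over an arbitrary type accommodates boxes with
  infinitely many successors. \<open>Leaf\<close> makes the type inhabited and witnesses
  nothing.\<close>

datatype 'x wtree = Leaf | Branch "'x \<Rightarrow> 'x wtree"

definition subtree :: "('x wtree \<times> 'x wtree) set" where
  "subtree = {(f x, Branch f) | f x. True}"

lemma wf_subtree: "wf subtree"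
proof (rule wfUNIVI)
  fix P :: "'x wtree \<Rightarrow> bool" and t
  assume step: "\<forall>t. (\<forall>s. (s, t) \<in> subtree \<longrightarrow> P s) \<longrightarrow> P t"
  show "P t"
  proof (induction t)
    case Leaf
    show ?case using step[rule_format, of Leaf] by (simp add: subtree_def)
  next
    case (Branch f)
    show ?case using step[rule_format, of "Branch f"] Branch by (auto simp: subtree_def)
  qed
qed

text \<open>
  A tree witnesses that a formula holds at a world without unfolding least fixpoints forever;
  greatest fixpoints are not unfolded but evaluated semantically. The children of a tree are
  indexed by all pairs of a world and a formula, of which only the relevant ones matter.
\<close>
primrec witness ::
  "('w, 'p, 'a) kripke \<Rightarrow> ('w \<times> ('p, 'a, 'v) fm) wtree \<Rightarrow> 'w \<Rightarrow> ('p, 'a, 'v) fm \<Rightarrow> bool" where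
  "witness K Leaf = (\<lambda>w \<phi>. False)"
| "witness K (Branch f) = (\<lambda>w \<phi>. case \<phi> of
      And \<psi> \<chi> \<Rightarrow> witness K (f (w, \<psi>)) w \<psi> \<and> witness K (f (w, \<chi>)) w \<chi>
    | Or \<psi> \<chi> \<Rightarrow> witness K (f (w, \<psi>)) w \<psi> \<or> witness K (f (w, \<chi>)) w \<chi>
    | Dia a \<psi> \<Rightarrow> (\<exists>v. (w, v) \<in> rel K a \<and> witness K (f (v, \<psi>)) v \<psi>)
    | Box a \<psi> \<Rightarrow> (\<forall>v. (w, v) \<in> rel K a \<longrightarrow> witness K (f (v, \<psi>)) v \<psi>)
    | Fix \<eta> X \<psi> \<Rightarrow>
        if \<eta> = Least
        then witness K (f (w, subst X (Fix \<eta> X \<psi>) \<psi>)) w (subst X (Fix \<eta> X \<psi>) \<psi>)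
        else w \<in> sem K (\<lambda>_. {}) \<phi>
    | _ \<Rightarrow> w \<in> sem K (\<lambda>_. {}) \<phi>)"

definition witnessed :: "('w, 'p, 'a) kripke \<Rightarrow> 'w \<Rightarrow> ('p, 'a, 'v) fm \<Rightarrow> bool" where
  "witnessed K w \<phi> \<longleftrightarrow> (\<exists>t. witness K t w \<phi>)"

text \<open>Chooses all subwitnesses at once, so that one \<open>Branch\<close> serves for every
  formula; entries without a witness are arbitrary.\<close>

definition some_witnesses ::
  "('w, 'p, 'a) kripke \<Rightarrow> ('w \<times> ('p, 'a, 'v) fm) \<Rightarrow> ('w \<times> ('p, 'a, 'v) fm) wtree" where
  "some_witnesses K x = (SOME t. witness K t (fst x) (snd x))"

lemma witness_some_witnesses: "witnessed K w \<phi> \<Longrightarrow> witness K (some_witnesses K (w, \<phi>)) w \<phi>"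
  unfolding witnessed_def some_witnesses_def by (auto intro: someI)

lemma witnessedI: "witness K (Branch (some_witnesses K)) w \<phi> \<Longrightarrow> witnessed K w \<phi>"
  unfolding witnessed_def by blast

text \<open>Each variable is read as the set of worlds that witness its replacement. The worlds
  witnessing a least fixpoint form a prefixed point and thus contain its semantics. The free
  variables of a greatest fixpoint lie in \<open>L\<close> by assumption and outside
  \<open>L\<close> by regularity, so it is closed and its truth is its witness.\<close>

lemma sem_witnessed:
  assumes "kripke_structure K" "regular L \<alpha>" "FV \<alpha> \<subseteq> L" "closing \<sigma>"
    and "\<And>Z. Z \<in> FV \<alpha> \<Longrightarrow> FV (\<sigma> Z) = {}"
    and "w \<in> sem K (\<lambda>Z. {v \<in> worlds K. witnessed K v (\<sigma> Z)}) \<alpha>"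
  shows "witnessed K w (psubst \<sigma> \<alpha>)"
  using assms
proof (induction \<alpha> arbitrary: \<sigma> w)
  case (And \<psi> \<phi>)
  have "witnessed K w (psubst \<sigma> \<psi>)" "witnessed K w (psubst \<sigma> \<phi>)"
    using And.prems by (auto intro!: And.IH)
  then show ?case by (intro witnessedI) (simp add: witness_some_witnesses)
next
  case (Or \<psi> \<phi>)
  have "witnessed K w (psubst \<sigma> \<psi>) \<or> witnessed K w (psubst \<sigma> \<phi>)"
    using Or.prems Or.IH(1)[of \<sigma> w] Or.IH(2)[of \<sigma> w] by auto
  then show ?case by (intro witnessedI) (auto simp: witness_some_witnesses)
next
  case (Dia a \<psi>)
  then obtain v where "(w, v) \<in> rel K a" "witnessed K v (psubst \<sigma> \<psi>)" by fastforce
  then show ?case by (intro witnessedI) (auto simp: witness_some_witnesses)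
next
  case (Box a \<psi>)
  have "witnessed K v (psubst \<sigma> \<psi>)" if "(w, v) \<in> rel K a" for v
    using Box.prems that by (auto intro!: Box.IH)
  then show ?case by (intro witnessedI) (auto simp: witness_some_witnesses)
next
  case (Fix \<eta> X \<psi>)
  show ?case
  proof (cases \<eta>)
    case Least
    let ?\<chi> = "psubst \<sigma> (Fix \<eta> X \<psi>)"
    let ?\<sigma> = "\<sigma>(X := ?\<chi>)"
    let ?i = "\<lambda>\<sigma> Z. {v \<in> worlds K. witnessed K v (\<sigma> Z)}"
    let ?S = "{v \<in> worlds K. witnessed K v ?\<chi>}"
    have cl: "FV ?\<chi> = {}"
      using Fix.prems(4,5) by (rule FV_psubst_closed)
    have upd: "?i ?\<sigma> = (?i \<sigma>)(X := ?S)" by (rule ext) simp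
    have unf: "subst X ?\<chi> (psubst (\<sigma>(X := Var X)) \<psi>) = psubst ?\<sigma> \<psi>"
      by (rule subst_psubst[OF Fix.prems(4)])
    have "v \<in> ?S" if v: "v \<in> sem K (?i ?\<sigma>) \<psi>" for v
    proof -
      have "witnessed K v (psubst ?\<sigma> \<psi>)"
      proof (rule Fix.IH)
        show "closing ?\<sigma>" using closing_upd(2)[OF Fix.prems(4) cl] .
        show "FV \<psi> \<subseteq> L" using Fix.prems(2,3) Least by auto
        show "FV (?\<sigma> Z) = {}" if "Z \<in> FV \<psi>" for Z using Fix.prems(5) cl that by auto
      qed (use v Fix.prems(1,2) in auto)
      then have "witnessed K v ?\<chi>"
        using unf Least by (intro witnessedI) (simp add: witness_some_witnesses)
      moreover have "v \<in> worlds K"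
        using v sem_subset_worlds[OF Fix.prems(1), of "?i ?\<sigma>" \<psi>] by blast
      ultimately show ?thesis by blast
    qed
    then have "sem K ((?i \<sigma>)(X := ?S)) \<psi> \<subseteq> ?S" unfolding upd by blast
    then have "sem K (?i \<sigma>) (Fix \<eta> X \<psi>) \<subseteq> ?S"
      unfolding Least sem.simps by (intro Inter_lower) simp
    then show ?thesis using Fix.prems(6) by blast
  next
    case Greatest
    then have cl: "FV (Fix \<eta> X \<psi>) = {}" using Fix.prems(2,3) by auto
    then have id: "psubst \<sigma> (Fix \<eta> X \<psi>) = Fix \<eta> X \<psi>" by (intro psubst_ident) blast
    have "w \<in> sem K (\<lambda>_. {}) (Fix \<eta> X \<psi>)"
      using Fix.prems(6) by (subst sem_closed[OF cl])
    then show ?thesis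
      unfolding id using Greatest by (intro witnessedI) simp
  qed
qed (auto intro!: witnessedI)

lemma closed_sem_witnessed:
  assumes "kripke_structure K" "regular L \<phi>" "FV \<phi> = {}" "w \<in> sem K (\<lambda>_. {}) \<phi>"
  shows "witnessed K w \<phi>"
  using sem_witnessed[OF assms(1,2) _ closing_Var, of w] assms(3,4)
    sem_closed[OF assms(3), of K "\<lambda>_. {}" "\<lambda>Z. {v \<in> worlds K. witnessed K v (Var Z :: ('b, 'c, 'd) fm)}"]
  by (simp add: psubst_ident)

section \<open>Tableau steps from satisfied nodes\<close>

fun unguarded_size :: "('p, 'a, 'v) fm \<Rightarrow> nat" where
  "unguarded_size (And \<psi> \<phi>) = Suc (unguarded_size \<psi> + unguarded_size \<phi>)"
| "unguarded_size (Or \<psi> \<phi>) = Suc (unguarded_size \<psi> + unguarded_size \<phi>)"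
| "unguarded_size (Fix \<eta> X \<psi>) = Suc (unguarded_size \<psi>)"
| "unguarded_size _ = 0"

text \<open>The replaced occurrences lie below modalities, where the size is 0. Hence unfolding a
  guarded fixpoint lowers the size by one.\<close>

lemma unguarded_size_subst:
  "guarded_var X \<phi> \<Longrightarrow> unguarded_size (subst X \<chi> \<phi>) = unguarded_size \<phi>"
  by (induction \<phi>) auto

definition satisfied_by ::
  "('w, 'p, 'a) kripke \<Rightarrow> 'v set \<Rightarrow> 'w \<Rightarrow> (('p, 'a, 'v) fm \<Rightarrow> ('w \<times> ('p, 'a, 'v) fm) wtree) \<Rightarrow>
    ('p, 'a, 'v) node \<Rightarrow> ('p, 'a, 'v) fm set \<Rightarrow> bool" where
  "satisfied_by K L w \<tau> \<Gamma> d \<longleftrightarrow> finite \<Gamma> \<and> d \<subseteq> deferrals \<Gamma> \<and>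
     (\<forall>\<phi> \<in> \<Gamma>. FV \<phi> = {} \<and> regular L \<phi> \<and> witness K (\<tau> \<phi>) w \<phi>)"

text \<open>
  Modal steps and steps on a focused formula shrink the witnesses of the focus; any other local
  step shrinks the part of the node that is not below a modality.
\<close>
definition rank ::
  "(('p, 'a, 'v) fm \<Rightarrow> 'x wtree) \<Rightarrow> ('p, 'a, 'v) node \<Rightarrow> ('p, 'a, 'v) fm set \<Rightarrow>
    'x wtree multiset \<times> nat" where
  "rank \<tau> \<Gamma> d = (image_mset \<tau> (mset_set d), sum unguarded_size \<Gamma>)"

definition rank_less :: "(('x wtree multiset \<times> nat) \<times> ('x wtree multiset \<times> nat)) set" where
  "rank_less = mult subtree <*lex*> less_than"

lemma wf_rank_less: "wf rank_less"
  unfolding rank_less_def by (intro wf_lex_prod wf_mult wf_subtree wf_less_than)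

text \<open>\<open>A\<close> is the part of the focus kept with its trees. It cancels, and the rest
  is a single step of the multiset order; \<open>A \<noteq> d\<close> ensures that some tree is
  removed.\<close>

lemma image_mset_mult:
  assumes "finite d" "finite d'" "A \<subseteq> d \<inter> d'" "A \<noteq> d" "\<And>x. x \<in> A \<Longrightarrow> g x = f x"
    and "\<And>x. x \<in> d' - A \<Longrightarrow> \<exists>y \<in> d - A. (g x, f y) \<in> r"
  shows "(image_mset g (mset_set d'), image_mset f (mset_set d)) \<in> mult r"
proof -
  have fin: "finite A" using assms(1,3) by (auto intro: finite_subset)
  have "d' = A \<union> (d' - A)" "d = A \<union> (d - A)" using assms(3) by auto
  then have eq: "mset_set d' = mset_set A + mset_set (d' - A)" "mset_set d = mset_set A + mset_set (d - A)"
    using assms(1,2) fin by (metis Diff_disjoint finite_Diff mset_set_Union)+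
  have "image_mset g (mset_set A) = image_mset f (mset_set A)"
    using assms(5) fin by (intro image_mset_cong) simp
  moreover have "image_mset f (mset_set (d - A)) \<noteq> {#}"
    using assms(1,3,4) by (auto simp: mset_set_empty_iff)
  ultimately show ?thesis
    unfolding eq image_mset_union using assms(1,2,6)
    by (auto intro!: one_step_implies_mult)
qed

lemma track_subset: "track d c \<subseteq> deferrals (fst c)"
  by (auto simp: track_def)

text \<open>If \<open>\<phi>\<close> is focused, its tree gives way to children and the multiset
  falls. Otherwise the focus keeps its trees: it either loses a formula, or stays the same while the
  unguarded size falls. Children are demanded only for focused \<open>\<phi>\<close>, since the
  witness for an unfolded greatest fixpoint is unrelated to the old one.\<close>

lemma local_step:
  assumes sat: "satisfied_by K L w \<tau> \<Gamma> d" and \<phi>: "\<phi> \<in> \<Gamma>" and S: "S \<subseteq> succs \<phi>" "finite S"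
    and size: "sum unguarded_size S < unguarded_size \<phi>"
    and t: "\<And>\<chi>. \<chi> \<in> S \<Longrightarrow> witness K (t \<chi>) w \<chi>"
      "\<And>\<chi>. \<chi> \<in> S \<Longrightarrow> \<phi> \<in> d \<Longrightarrow> (t \<chi>, \<tau> \<phi>) \<in> subtree"
    and c: "c = replace \<Gamma> \<phi> S"
  shows "\<exists>w' \<tau>'. satisfied_by K L w' \<tau>' (fst c) (track d c) \<and>
    (d \<noteq> {} \<longrightarrow> (rank \<tau>' (fst c) (track d c), rank \<tau> \<Gamma> d) \<in> rank_less)"
proof (intro exI conjI impI)
  \<comment> \<open>A formula of \<open>S\<close> may already stand in
    \<open>\<Gamma> - {\<phi>}\<close>. It takes the new tree if \<open>\<phi>\<close> is focused
    and otherwise keeps the old one, so that the trees of the focus do not change.\<close>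
  define \<tau>' where
    "\<tau>' \<chi> = (if \<chi> \<in> S \<and> (\<phi> \<in> d \<or> \<chi> \<notin> \<Gamma> - {\<phi>}) then t \<chi> else \<tau> \<chi>)" for \<chi>
  have fst_c: "fst c = (\<Gamma> - {\<phi>}) \<union> S" by (simp add: c replace_def)
  have fin: "finite \<Gamma>" using sat by (simp add: satisfied_by_def)
  have d: "d \<subseteq> \<Gamma>" using sat by (auto simp: satisfied_by_def deferrals_def)
  show "satisfied_by K L w \<tau>' (fst c) (track d c)"
    unfolding satisfied_by_def
  proof (intro conjI ballI)
    show "finite (fst c)" using fin S by (simp add: fst_c)
    show "track d c \<subseteq> deferrals (fst c)" by (rule track_subset)
    fix \<chi> assume \<chi>: "\<chi> \<in> fst c"
    then show "FV \<chi> = {}" "regular L \<chi>"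
      using sat S \<phi> regular_succs[of \<phi> L \<chi>] by (auto simp: fst_c satisfied_by_def)
    show "witness K (\<tau>' \<chi>) w \<chi>"
      using \<chi> sat t(1) by (auto simp: fst_c satisfied_by_def \<tau>'_def)
  qed
  assume ne: "d \<noteq> {}"
  let ?d = "track d c"
  have fin_d: "finite d" "finite ?d"
    using finite_subset[OF d fin] finite_subset[OF track_subset, of c d] fin S
    by (auto simp: fst_c deferrals_def)
  have d': "?d \<subseteq> (d - {\<phi>}) \<union> (if \<phi> \<in> d then S else {})"
    using ne by (auto simp: track_def c replace_def)
  have "sum unguarded_size (fst c) \<le> sum unguarded_size (\<Gamma> - {\<phi>}) + sum unguarded_size S"
    unfolding fst_c using fin S by (simp add: sum_Un_nat)
  also have "\<dots> < sum unguarded_size \<Gamma>"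
    using size sum.remove[OF fin \<phi>, of unguarded_size] by simp
  finally have sum_less: "sum unguarded_size (fst c) < sum unguarded_size \<Gamma>" .
  show "(rank \<tau>' (fst c) ?d, rank \<tau> \<Gamma> d) \<in> rank_less"
  proof (cases "\<phi> \<in> d")
    case True
    have "(image_mset \<tau>' (mset_set ?d), image_mset \<tau> (mset_set d)) \<in> mult subtree"
    proof (rule image_mset_mult[OF fin_d, where A = "?d - S"])
      show "?d - S \<subseteq> d \<inter> ?d" "?d - S \<noteq> d" using True d' by auto
      show "\<tau>' x = \<tau> x" if "x \<in> ?d - S" for x using that by (simp add: \<tau>'_def)
      show "\<exists>y \<in> d - (?d - S). (\<tau>' x, \<tau> y) \<in> subtree" if "x \<in> ?d - (?d - S)" for x
        using that True d' t(2)[of x] by (intro bexI[of _ \<phi>]) (auto simp: \<tau>'_def)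
    qed
    then show ?thesis by (simp add: rank_def rank_less_def)
  next
    case False
    then have sub: "?d \<subseteq> d - {\<phi>}" using d' by simp
    then have eq: "\<tau>' x = \<tau> x" if "x \<in> ?d" for x
      using that d False by (auto simp: \<tau>'_def)
    show ?thesis
    proof (cases "?d = d")
      case True
      have "image_mset \<tau>' (mset_set ?d) = image_mset \<tau> (mset_set ?d)"
        using eq fin_d(2) by (intro image_mset_cong) simp
      then have "image_mset \<tau>' (mset_set ?d) = image_mset \<tau> (mset_set d)"
        by (simp only: True)
      then show ?thesis using sum_less by (simp add: rank_def rank_less_def)
    next
      case False
      have "(image_mset \<tau>' (mset_set ?d), image_mset \<tau> (mset_set d)) \<in> mult subtree"
        by (rule image_mset_mult[OF fin_d, where A = "?d"]) (use sub False eq in auto)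
      then show ?thesis by (simp add: rank_def rank_less_def)
    qed
  qed
qed

text \<open>The next world is the successor picked by the tree of the diamond, and every formula of
  the conclusion inherits a child of the tree of its source. So the multiset falls with no part of
  the focus kept.\<close>

lemma modal_step:
  assumes sat: "satisfied_by K L w \<tau> \<Gamma> d" and \<phi>: "Dia a \<phi> \<in> \<Gamma>"
    and c: "c = (insert \<phi> {\<psi>. Box a \<psi> \<in> \<Gamma>}, insert (Dia a \<phi>, \<phi>) {(Box a \<psi>, \<psi>) | \<psi>. Box a \<psi> \<in> \<Gamma>})"
  shows "\<exists>w' \<tau>'. satisfied_by K L w' \<tau>' (fst c) (track d c) \<and>
    (d \<noteq> {} \<longrightarrow> (rank \<tau>' (fst c) (track d c), rank \<tau> \<Gamma> d) \<in> rank_less)"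
proof -
  let ?d = "track d c"
  have fin: "finite \<Gamma>" using sat by (simp add: satisfied_by_def)
  have d: "d \<subseteq> \<Gamma>" using sat by (auto simp: satisfied_by_def deferrals_def)
  have wit: "witness K (\<tau> \<chi>) w \<chi>" if "\<chi> \<in> \<Gamma>" for \<chi> using sat that by (simp add: satisfied_by_def)
  obtain v where v: "(w, v) \<in> rel K a" and t\<phi>: "\<exists>t. witness K t v \<phi> \<and> (t, \<tau> (Dia a \<phi>)) \<in> subtree"
    using wit[OF \<phi>] by (cases "\<tau> (Dia a \<phi>)") (auto simp: subtree_def)
  have t\<psi>: "\<exists>t. witness K t v \<psi> \<and> (t, \<tau> (Box a \<psi>)) \<in> subtree" if "Box a \<psi> \<in> \<Gamma>" for \<psi>
    using wit[OF that] v by (cases "\<tau> (Box a \<psi>)") (auto simp: subtree_def)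
  have src: "\<exists>t. witness K t v \<chi> \<and> (t, \<tau> \<psi>) \<in> subtree" if "(\<psi>, \<chi>) \<in> snd c" for \<psi> \<chi>
    using that t\<phi> t\<psi> by (auto simp: c)
  \<comment> \<open>A formula can stem both from the diamond and from a box; if it is in the new
    focus, its tree must come from a focused source.\<close>
  have "\<exists>t. witness K t v \<chi> \<and> (d \<noteq> {} \<longrightarrow> \<chi> \<in> ?d \<longrightarrow> (\<exists>\<psi> \<in> d. (t, \<tau> \<psi>) \<in> subtree))"
    if \<chi>: "\<chi> \<in> fst c" for \<chi>
  proof (cases "d \<noteq> {} \<and> \<chi> \<in> ?d")
    case True
    then obtain \<psi> where "\<psi> \<in> d" "(\<psi>, \<chi>) \<in> snd c"
      by (auto simp: track_def split: if_splits)
    then show ?thesis using src by blast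
  next
    case False
    obtain \<psi> where "(\<psi>, \<chi>) \<in> snd c" using \<chi> by (auto simp: c)
    then show ?thesis using src False by blast
  qed
  then obtain \<tau>' where \<tau>': "\<And>\<chi>. \<chi> \<in> fst c \<Longrightarrow> witness K (\<tau>' \<chi>) v \<chi> \<and>
      (d \<noteq> {} \<longrightarrow> \<chi> \<in> ?d \<longrightarrow> (\<exists>\<psi> \<in> d. (\<tau>' \<chi>, \<tau> \<psi>) \<in> subtree))"
    by metis
  have "finite (Box a -` \<Gamma>)" by (rule finite_vimageI[OF fin]) (simp add: inj_def)
  then have fin_c: "finite (fst c)" by (simp add: c vimage_def)
  have "satisfied_by K L v \<tau>' (fst c) ?d"
    unfolding satisfied_by_def
  proof (intro conjI ballI)
    fix \<chi> assume \<chi>: "\<chi> \<in> fst c"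
    then show "FV \<chi> = {}" "regular L \<chi>"
      using sat \<phi> by (auto simp: c satisfied_by_def)
    show "witness K (\<tau>' \<chi>) v \<chi>" using \<tau>'[OF \<chi>] by simp
  qed (use fin_c track_subset[of d c] in auto)
  moreover have "(rank \<tau>' (fst c) ?d, rank \<tau> \<Gamma> d) \<in> rank_less" if "d \<noteq> {}"
  proof -
    have "(image_mset \<tau>' (mset_set ?d), image_mset \<tau> (mset_set d)) \<in> mult subtree"
    proof (rule image_mset_mult[where A = "{}"])
      show "finite d" using finite_subset[OF d fin] .
      have "?d \<subseteq> fst c" using track_subset[of d c] by (auto simp: deferrals_def)
      then show "finite ?d" using fin_c finite_subset by blast
      show "\<exists>y \<in> d - {}. (\<tau>' x, \<tau> y) \<in> subtree" if "x \<in> ?d - {}" for x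
        using \<tau>'[of x] that \<open>?d \<subseteq> fst c\<close> \<open>d \<noteq> {}\<close> by auto
    qed (use that in auto)
    then show ?thesis by (simp add: rank_def rank_less_def)
  qed
  ultimately show ?thesis by blast
qed

text \<open>Rules without conclusions contradict the witnesses, and a disjunction follows the
  disjunct that is witnessed. No descent is claimed for an empty focus, as tracking then refocuses
  on all deferrals.\<close>

lemma concl_step:
  assumes K: "kripke_structure K" and sat: "satisfied_by K L w \<tau> \<Gamma> d" and \<Sigma>: "\<Sigma> \<in> concl \<Gamma>"
  shows "\<exists>c \<in> \<Sigma>. \<exists>w' \<tau>'. satisfied_by K L w' \<tau>' (fst c) (track d c) \<and>
    (d \<noteq> {} \<longrightarrow> (rank \<tau>' (fst c) (track d c), rank \<tau> \<Gamma> d) \<in> rank_less)"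
proof (cases "state_node \<Gamma>")
  case True
  then have "modal_rule \<Gamma> \<Sigma>" using \<Sigma> by (simp add: concl_def)
  then show ?thesis using modal_step[OF sat] by cases blast
next
  case False
  have wit: "witness K (\<tau> \<chi>) w \<chi>" "FV \<chi> = {}" "regular L \<chi>" if "\<chi> \<in> \<Gamma>" for \<chi>
    using sat that by (auto simp: satisfied_by_def)
  have literal: "w \<in> sem K (\<lambda>_. {}) \<chi>" if "\<chi> \<in> \<Gamma>" "succs \<chi> = {}" for \<chi>
    using wit[OF that(1)] that(2) by (cases "\<tau> \<chi>"; cases \<chi>) auto
  have "local_rule \<Gamma> \<Sigma>" using False \<Sigma> by (simp add: concl_def)
  then show ?thesis
  proof cases
    case bot
    then show ?thesis using literal[of Bot] by simp
  next
    case (clash p)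
    then show ?thesis using literal[of "Prp p"] literal[of "NPrp p"] by simp
  next
    case (conj \<psi> \<phi>)
    obtain f where f: "\<tau> (And \<psi> \<phi>) = Branch f"
      using wit(1)[OF conj(2)] by (cases "\<tau> (And \<psi> \<phi>)") auto
    have "\<exists>w' \<tau>'. satisfied_by K L w' \<tau>' (fst c) (track d c) \<and>
      (d \<noteq> {} \<longrightarrow> (rank \<tau>' (fst c) (track d c), rank \<tau> \<Gamma> d) \<in> rank_less)"
      if "c = replace \<Gamma> (And \<psi> \<phi>) {\<psi>, \<phi>}" for c
    proof (rule local_step[OF sat conj(2) _ _ _ _ _ that, where t = "\<lambda>\<chi>. f (w, \<chi>)"])
      show "sum unguarded_size {\<psi>, \<phi>} < unguarded_size (And \<psi> \<phi>)" by (cases "\<psi> = \<phi>") auto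
      show "witness K (f (w, \<chi>)) w \<chi>" if "\<chi> \<in> {\<psi>, \<phi>}" for \<chi>
        using that wit(1)[OF conj(2)] f by auto
    qed (auto simp: f subtree_def)
    then show ?thesis using conj(1) by blast
  next
    case (disj \<psi> \<phi>)
    obtain f where f: "\<tau> (Or \<psi> \<phi>) = Branch f"
      using wit(1)[OF disj(2)] by (cases "\<tau> (Or \<psi> \<phi>)") auto
    obtain \<chi> where \<chi>: "\<chi> \<in> {\<psi>, \<phi>}" "witness K (f (w, \<chi>)) w \<chi>"
      using wit(1)[OF disj(2)] f by auto
    have "\<exists>w' \<tau>'. satisfied_by K L w' \<tau>' (fst c) (track d c) \<and>
      (d \<noteq> {} \<longrightarrow> (rank \<tau>' (fst c) (track d c), rank \<tau> \<Gamma> d) \<in> rank_less)"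
      if "c = replace \<Gamma> (Or \<psi> \<phi>) {\<chi>}" for c
      by (rule local_step[OF sat disj(2) _ _ _ _ _ that, where t = "\<lambda>\<chi>. f (w, \<chi>)"])
        (use \<chi> in \<open>auto simp: f subtree_def\<close>)
    then show ?thesis using disj(1) \<chi>(1) by blast
  next
    case (unfold \<eta> X \<psi>)
    let ?\<phi> = "Fix \<eta> X \<psi>"
    let ?\<chi> = "subst X ?\<phi> \<psi>"
    obtain f where f: "\<tau> ?\<phi> = Branch f"
      using wit(1)[OF unfold(2)] by (cases "\<tau> ?\<phi>") auto
    have "\<exists>t. witness K t w ?\<chi> \<and> (?\<phi> \<in> d \<longrightarrow> (t, \<tau> ?\<phi>) \<in> subtree)"
    proof (cases \<eta>)
      case Least
      then show ?thesis using wit(1)[OF unfold(2)] f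
        by (intro exI[of _ "f (w, ?\<chi>)"]) (auto simp: subtree_def)
    next
      case Greatest
      \<comment> \<open>The witness for the unfolding is rebuilt from the semantics and need not be
        smaller; this is harmless because a greatest fixpoint is never focused.\<close>
      have "?\<phi> \<notin> d"
        using Greatest Greatest_not_deferral[of L X \<psi>] wit(3)[OF unfold(2)] sat
        by (auto simp: satisfied_by_def deferrals_def)
      have "w \<in> sem K (\<lambda>_. {}) ?\<phi>" using wit(1)[OF unfold(2)] f Greatest by simp
      then have "w \<in> sem K (\<lambda>_. {}) ?\<chi>"
        using sem_Greatest_unfold[of X \<psi> K "\<lambda>_. {}"] wit(2)[OF unfold(2)] Greatest by blast
      then have "witnessed K w ?\<chi>"
        using closed_sem_witnessed[OF K, of L ?\<chi> w] regular_succs[OF wit(2,3)[OF unfold(2)], of ?\<chi>]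
        by simp
      then show ?thesis using \<open>?\<phi> \<notin> d\<close> by (auto simp: witnessed_def)
    qed
    then obtain t where t: "witness K t w ?\<chi>" "?\<phi> \<in> d \<longrightarrow> (t, \<tau> ?\<phi>) \<in> subtree" by blast
    have "\<exists>w' \<tau>'. satisfied_by K L w' \<tau>' (fst c) (track d c) \<and>
      (d \<noteq> {} \<longrightarrow> (rank \<tau>' (fst c) (track d c), rank \<tau> \<Gamma> d) \<in> rank_less)"
      if "c = replace \<Gamma> ?\<phi> {?\<chi>}" for c
      by (rule local_step[OF sat unfold(2) _ _ _ _ _ that, where t = "\<lambda>_. t"])
        (use t wit(3)[OF unfold(2)] in \<open>auto simp: unguarded_size_subst\<close>)
    then show ?thesis using unfold(1) by blast
  qed
qed

section \<open>Propagation\<close>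

text \<open>\<open>Q m \<Gamma> d\<close> is meant as: \<open>m\<close> is a possible rank of the
  satisfied node. One step property then serves both \<open>E_set\<close> and
  \<open>A_set\<close>.\<close>

locale ranked_nodes =
  fixes Q :: "'m \<Rightarrow> ('p, 'a, 'v) node \<Rightarrow> ('p, 'a, 'v) fm set \<Rightarrow> bool" and R :: "('m \<times> 'm) set"
  assumes wf: "wf R"
    and step: "Q m \<Gamma> d \<Longrightarrow> \<Sigma> \<in> concl \<Gamma> \<Longrightarrow>
      \<exists>c \<in> \<Sigma>. \<exists>m'. Q m' (fst c) (track d c) \<and> (d \<noteq> {} \<longrightarrow> (m', m) \<in> R)"
begin

text \<open>Coinduction with the ranked nodes \<open>?X\<close> for the outer fixpoint, well-founded
  induction on the rank for the inner one: a focused node passes to lower ranks, an unfocused one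
  back to \<open>?X\<close>. Closedness of \<open>G\<close> keeps conclusions inside
  \<open>fnodes G\<close>.\<close>

lemma in_E_set:
  assumes closed: "\<And>t \<Sigma> c. t \<in> G \<Longrightarrow> \<Sigma> \<in> concl t \<Longrightarrow> c \<in> \<Sigma> \<Longrightarrow> fst c \<in> G"
    and "Q m \<Gamma> d" "(\<Gamma>, d) \<in> fnodes G"
  shows "(\<Gamma>, d) \<in> E_set G"
proof -
  let ?X = "{(\<Gamma>, d) \<in> fnodes G. \<exists>m. Q m \<Gamma> d}"
  have next_fnode: "(fst c, track d c) \<in> fnodes G"
    if "(\<Gamma>, d) \<in> fnodes G" "\<Sigma> \<in> concl \<Gamma>" "c \<in> \<Sigma>" for \<Gamma> d \<Sigma> c
    using that(1) closed[OF _ that(2,3)] track_subset[of d c] by (simp add: fnodes_def)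
  have "?X \<subseteq> lfp (f_hat G ?X)"
  proof (rule lfp_greatest)
    fix u assume u: "f_hat G ?X u \<subseteq> u"
    have "(\<Gamma>, d) \<in> u" if "Q m \<Gamma> d" "(\<Gamma>, d) \<in> fnodes G" for m \<Gamma> d
      using wf that
    proof (induction m arbitrary: \<Gamma> d rule: wf_induct_rule)
      case (less m)
      have "(\<Gamma>, d) \<in> f_hat G ?X u"
      proof (cases "d = {}")
        case True
        have "\<exists>c \<in> \<Sigma>. (fst c, track d c) \<in> ?X" if "\<Sigma> \<in> concl \<Gamma>" for \<Sigma>
          using step[OF less.prems(1) that] next_fnode[OF less.prems(2) that] by blast
        then show ?thesis using True less.prems(2) by (auto simp: f_hat_def ff_def unfocused_def)
      next
        case False
        have "\<exists>c \<in> \<Sigma>. (fst c, track d c) \<in> u" if "\<Sigma> \<in> concl \<Gamma>" for \<Sigma>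
          using step[OF less.prems(1) that] next_fnode[OF less.prems(2) that] False less.IH by blast
        then show ?thesis using False less.prems(2) by (auto simp: f_hat_def ff_def focused_def)
      qed
      then show ?case using u by blast
    qed
    then show "?X \<subseteq> u" by blast
  qed
  then have "?X \<subseteq> E_set G" unfolding E_set_def by (rule gfp_upperbound)
  then show ?thesis using assms(2,3) by blast
qed

text \<open>Dually, the nodes without a rank form a prefixed point of the outer operator, because
  ranked nodes avoid every postfixed point of the inner one. As \<open>G\<close> is arbitrary,
  \<open>No\<close> is ruled out at intermediate checks too.\<close>

lemma notin_A_set:
  assumes "Q m \<Gamma> d"
  shows "(\<Gamma>, d) \<notin> A_set G"
proof -
  let ?B = "{(\<Gamma>, d). \<nexists>m. Q m \<Gamma> d}"
  have "gfp (g_hat G ?B) \<subseteq> ?B"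
  proof (rule gfp_least)
    fix u assume u: "u \<subseteq> g_hat G ?B u"
    have "(\<Gamma>, d) \<notin> u" if "Q m \<Gamma> d" for m \<Gamma> d
      using wf that
    proof (induction m arbitrary: \<Gamma> d rule: wf_induct_rule)
      case (less m)
      show ?case
      proof
        assume "(\<Gamma>, d) \<in> u"
        then have hat: "(\<Gamma>, d) \<in> g_hat G ?B u" using u by blast
        show False
        proof (cases "d = {}")
          case True
          then obtain \<Sigma> where "\<Sigma> \<in> concl \<Gamma>" "\<forall>c \<in> \<Sigma>. (fst c, track d c) \<in> ?B"
            using hat by (auto simp: g_hat_def gg_def focused_def)
          then show False using step[OF less.prems] by blast
        next
          case False
          then obtain \<Sigma> where "\<Sigma> \<in> concl \<Gamma>" "\<forall>c \<in> \<Sigma>. (fst c, track d c) \<in> u"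
            using hat by (auto simp: g_hat_def gg_def unfocused_def)
          then show False using step[OF less.prems] less.IH False by blast
        qed
      qed
    qed
    then show "u \<subseteq> ?B" by blast
  qed
  then have "A_set G \<subseteq> ?B" unfolding A_set_def by (rule lfp_lowerbound)
  then show ?thesis using assms by blast
qed

end

section \<open>Runs of the algorithm\<close>

text \<open>The last conjunct makes \<open>G\<close> closed under conclusions once \<open>U\<close>
  is empty; the clause for \<open>Return\<close> encodes the answer to be proved.\<close>

fun run_invariant ::
  "('p, 'a, 'v) fm set \<Rightarrow> ('p, 'a, 'v) node \<Rightarrow> ('p, 'a, 'v) config \<Rightarrow> bool" where
  "run_invariant C \<Gamma>\<^sub>0 (Expand G U) \<longleftrightarrow> G \<union> U \<subseteq> Pow C \<and> G \<inter> U = {} \<and> \<Gamma>\<^sub>0 \<in> G \<union> U \<and>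
     (\<forall>t \<in> G. fst ` \<Union> (concl t) \<subseteq> G \<union> U)"
| "run_invariant C \<Gamma>\<^sub>0 (Check G U) \<longleftrightarrow> G \<union> U \<subseteq> Pow C \<and> G \<inter> U = {} \<and> \<Gamma>\<^sub>0 \<in> G \<union> U \<and>
     (\<forall>t \<in> G. fst ` \<Union> (concl t) \<subseteq> G \<union> U)"
| "run_invariant C \<Gamma>\<^sub>0 (Return r) \<longleftrightarrow> r = Yes"

text \<open>The factor 2 pays for \<open>expand\<close> and the following \<open>continue\<close>: a
  new node in \<open>G\<close> saves 2, of which the move to \<open>Check\<close> spends 1.\<close>

fun remaining :: "('p, 'a, 'v) fm set \<Rightarrow> ('p, 'a, 'v) config \<Rightarrow> nat" where
  "remaining C (Expand G U) = 2 * card (Pow C - G) + 1"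
| "remaining C (Check G U) = 2 * card (Pow C - G) + 2"
| "remaining C (Return r) = 0"

lemma remaining_decreases:
  assumes "finite C" "run_invariant C \<Gamma>\<^sub>0 s" "gc_step \<Gamma>\<^sub>0 s s'"
  shows "remaining C s' < remaining C s"
  using assms(3,2)
proof cases
  case (expand t U G' G U')
  then have "t \<in> Pow C - G" "Pow C - G' = (Pow C - G) - {t}" using assms(2) by auto
  then have "card (Pow C - G') < card (Pow C - G)"
    using assms(1) by (metis card_Diff1_less finite_Diff finite_Pow_iff)
  then show ?thesis using expand by simp
qed auto

text \<open>\<open>A\<close> rules out \<open>early_no\<close>; \<open>E\<close> makes
  \<open>final\<close> answer \<open>Yes\<close>, as \<open>G\<close> is closed when
  \<open>U\<close> is empty.\<close>

lemma run_invariant_step: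
  assumes C: "\<And>t \<Sigma> c. t \<subseteq> C \<Longrightarrow> \<Sigma> \<in> concl t \<Longrightarrow> c \<in> \<Sigma> \<Longrightarrow> fst c \<subseteq> C"
    and A: "\<And>G. (\<Gamma>\<^sub>0, deferrals \<Gamma>\<^sub>0) \<notin> A_set G"
    and E: "\<And>G. \<Gamma>\<^sub>0 \<in> G \<Longrightarrow> (\<And>t. t \<in> G \<Longrightarrow> fst ` \<Union> (concl t) \<subseteq> G) \<Longrightarrow>
      (\<Gamma>\<^sub>0, deferrals \<Gamma>\<^sub>0) \<in> E_set G"
    and inv: "run_invariant C \<Gamma>\<^sub>0 s" and step: "gc_step \<Gamma>\<^sub>0 s s'"
  shows "run_invariant C \<Gamma>\<^sub>0 s'"
  using step
proof cases
  case (expand t U G' G U')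
  have "t \<subseteq> C" using inv expand by auto
  then have sub: "fst ` \<Union> (concl t) \<subseteq> Pow C" using C[of t] by blast
  have closed: "fst ` \<Union> (concl t') \<subseteq> G' \<union> U'" if t': "t' \<in> G'" for t'
  proof (cases "t' = t")
    case True
    then show ?thesis using expand(5) by blast
  next
    case False
    then have "t' \<in> G" using t' expand(4) by simp
    then have "fst ` \<Union> (concl t') \<subseteq> G \<union> U" using inv expand(1) by simp
    also have "\<dots> \<subseteq> G' \<union> U'" using expand(4,5) by blast
    finally show ?thesis .
  qed
  have inv': "G \<union> U \<subseteq> Pow C" "G \<inter> U = {}" "\<Gamma>\<^sub>0 \<in> G \<union> U" using inv expand by simp_all
  have "G' \<union> U' \<subseteq> Pow C"
    using inv'(1) sub expand(3-5) by blast
  moreover have "G' \<inter> U' = {}" using inv'(2) expand(3-5) by blast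
  moreover have "\<Gamma>\<^sub>0 \<in> G' \<union> U'" using inv'(3) expand(3-5) by blast
  ultimately show ?thesis using closed expand(2) by simp
next
  case (final G)
  then have "(\<Gamma>\<^sub>0, deferrals \<Gamma>\<^sub>0) \<in> E_set G" using inv by (intro E) auto
  then show ?thesis using final by simp
qed (use inv A in auto)

text \<open>The measure \<open>remaining\<close> bounds the length of runs. Every configuration
  other than \<open>Return\<close> has a step, so a stuck one carries the answer fixed by the
  invariant.\<close>

lemma gc_returns_Yes_if_invariant:
  assumes fin: "finite C"
    and init: "run_invariant C {\<phi>} (gc_init \<phi>)"
    and pres: "\<And>s s'. run_invariant C {\<phi>} s \<Longrightarrow> gc_step {\<phi>} s s' \<Longrightarrow> run_invariant C {\<phi>} s'"
  shows "gc_returns \<phi> Yes"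
  unfolding gc_returns_def
proof (intro conjI allI impI notI; (elim exE conjE)?)
  fix s :: "nat \<Rightarrow> ('a, 'b, 'c) config"
  assume s: "s 0 = gc_init \<phi>" "\<forall>i. gc_step {\<phi>} (s i) (s (Suc i))"
  have inv: "run_invariant C {\<phi>} (s i)" for i
    by (induction i) (use s init pres in auto)
  have "remaining C (s i) + i \<le> remaining C (s 0)" for i
  proof (induction i)
    case (Suc i)
    have "remaining C (s (Suc i)) < remaining C (s i)"
      using remaining_decreases[OF fin inv[of i]] s(2) by blast
    then show ?case using Suc by simp
  qed simp
  from this[of "Suc (remaining C (s 0))"] show False by simp
next
  fix s assume reach: "(gc_step {\<phi>})\<^sup>*\<^sup>* (gc_init \<phi>) s" and stuck: "\<nexists>s'. gc_step {\<phi>} s s'"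
  from reach have inv: "run_invariant C {\<phi>} s"
    by (induction rule: rtranclp_induct) (use init pres in auto)
  show "s = Return Yes"
  proof (cases s)
    case (Expand G U)
    then show ?thesis
      using stuck gc_step.expand[of _ U _ G] gc_step.final[of "{\<phi>}" G] by (cases "U = {}") blast+
  next
    case (Check G U)
    then show ?thesis using stuck gc_step.continue by blast
  next
    case (Return r)
    then show ?thesis using inv by simp
  qed
qed

theorem theorem21:
  fixes \<phi>\<^sub>0 :: "('p, 'a, 'v) fm"
  assumes "closed_fm \<phi>\<^sub>0"
    and "guarded \<phi>\<^sub>0"
    and "clean \<phi>\<^sub>0"
    and "irredundant \<phi>\<^sub>0"
    and "alternation_free \<phi>\<^sub>0"
    and "satisfiable TYPE('w) \<phi>\<^sub>0"
  shows "gc_returns \<phi>\<^sub>0 Yes"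
proof -
  let ?\<Gamma> = "{\<phi>\<^sub>0}" and ?L = "fp_vars Least \<phi>\<^sub>0"
  obtain K :: "('w, 'p, 'a) kripke" and w where
    K: "kripke_structure K" and w: "w \<in> sem K (\<lambda>_. {}) \<phi>\<^sub>0"
    using assms(6) by (auto simp: satisfiable_def)
  let ?Q = "\<lambda>m \<Gamma> d. \<exists>w \<tau>. satisfied_by K ?L w \<tau> \<Gamma> d \<and> m = rank \<tau> \<Gamma> d"
  interpret ranked_nodes ?Q rank_less
  proof
    show "wf rank_less" by (rule wf_rank_less)
    show "\<exists>c \<in> \<Sigma>. \<exists>m'. ?Q m' (fst c) (track d c) \<and> (d \<noteq> {} \<longrightarrow> (m', m) \<in> rank_less)"
      if "?Q m \<Gamma> d" "\<Sigma> \<in> concl \<Gamma>" for m \<Gamma> d \<Sigma>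
      using that concl_step[OF K] by blast
  qed
  have reg: "regular ?L \<phi>\<^sub>0" using assms(2,4,5) by (rule regular_fp_vars)
  have cl: "FV \<phi>\<^sub>0 = {}" using assms(1) by (simp add: closed_fm_def)
  obtain t where "witness K t w \<phi>\<^sub>0"
    using closed_sem_witnessed[OF K reg cl w] by (auto simp: witnessed_def)
  \<comment> \<open>A constant assignment suffices, as the initial node has just one
    formula.\<close>
  then have "satisfied_by K ?L w (\<lambda>_. t) ?\<Gamma> (deferrals ?\<Gamma>)"
    using reg cl by (simp add: satisfied_by_def)
  then obtain m where Q: "?Q m ?\<Gamma> (deferrals ?\<Gamma>)" by blast
  obtain C where C: "finite C" "\<phi>\<^sub>0 \<in> C" "\<And>\<alpha>. \<alpha> \<in> C \<Longrightarrow> succs \<alpha> \<subseteq> C"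
    using finite_succs_closed_superset[OF assms(1)] by blast
  show ?thesis
  proof (rule gc_returns_Yes_if_invariant[OF C(1)])
    show "run_invariant C ?\<Gamma> (gc_init \<phi>\<^sub>0)" using C(2) by (simp add: gc_init_def)
    show "run_invariant C ?\<Gamma> s'" if "run_invariant C ?\<Gamma> s" "gc_step ?\<Gamma> s s'" for s s'
    proof (rule run_invariant_step[OF _ _ _ that])
      show "fst c \<subseteq> C" if "t \<subseteq> C" "\<Sigma> \<in> concl t" "c \<in> \<Sigma>" for t \<Sigma> c
        using concl_subset_succs[OF that(2,3)] that(1) C(3) by blast
      show "(?\<Gamma>, deferrals ?\<Gamma>) \<notin> A_set G" for G by (rule notin_A_set[OF Q])
      show "(?\<Gamma>, deferrals ?\<Gamma>) \<in> E_set G"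
        if "?\<Gamma> \<in> G" "\<And>t. t \<in> G \<Longrightarrow> fst ` \<Union> (concl t) \<subseteq> G" for G
        using that by (intro in_E_set[OF _ Q]) (auto simp: fnodes_def)
    qed
  qed
qed

end
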